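(* Let $k\ge2$, let $2\le r_1<\dots<r_k$ and $s_1,\dots,s_k\ge1$ be integers, and let $\mathbb{L}_1$ be the Lorenz braid defined by $\vec d_{L_1}=\langle r_1^{s_1},\dots,r_k^{s_k}\rangle$, where $r_{k-1}\le s_k$ and $s_i=n_i\cdot r_i$ for some positive integers $n_i$, $i=1,\dots,k-1$. Let $\mathbb{L}_2$ be the Lorenz braid defined by $\vec d_{L_2}=\langle r_1^{s_1},\dots,r_{k-1}^{s_{k-1}},\,s_k^{r_k}\rangle$. Then $\mathbb{L}_1$ and $\mathbb{L}_2$ both represent the same Lorenz link, i.e. their closures are isotopic links.
   Context: For integers $p\ge 1$ and $1\le d_1\le d_2\le\dots\le d_p$, the Lorenz braid with defining vector $\langle d_1,\dots,d_p\rangle$ is the positive braid on $p+d_p$ strands in which, for $1\le i\le p$, the strand beginning at position $i$ (an overcrossing strand) ends at position $i+d_i$; the $d_p$ strands beginning at positions $p+1,\dots,p+d_p$ (undercrossing strands) fill the remaining end positions in order-preserving fashion; any two strands cross at most once, and every crossing is an overcrossing strand passing over an undercrossing strand, all crossings being positive. The notation $r^{s}$ inside a vector means $r$ repeated $s$ times (so a vector such as $\langle r_1^{s_1},\dots,r_k^{s_k}\rangle$ has $p=s_1+\dots+s_k$ entries). A Lorenz link is a link which is the closure of a Lorenz braid. *)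

theory Defs
  imports "HOL-Analysis.Analysis"
begin

section \<open>Isotopy of links in three-space\<close>

definition isotopic_links :: "(real^3) set \<Rightarrow> (real^3) set \<Rightarrow> bool" where
  "isotopic_links K L \<longleftrightarrow>
     (\<exists>h. homotopic_with_canon (\<lambda>f. \<exists>g. homeomorphism UNIV UNIV f g) UNIV UNIV id h
          \<and> h ` K = L)"


section \<open>Geometric braids and their closures\<close>

text \<open>
  A braid on \<open>n\<close> strands is a family \<open>b\<close>: at level \<open>t \<in> [0, 1]\<close> the strand that begins
  at position \<open>i \<in> {1..n}\<close> is at \<open>b i t = (x, z)\<close>, where \<open>x\<close> runs along the line of positions
  and \<open>z\<close> is the height over the plane onto which the braid is projected. Positivity of \<open>x\<close>
  keeps the strands off the axis around which the braid is closed up.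
\<close>

definition geometric_braid :: "nat \<Rightarrow> (nat \<Rightarrow> real \<Rightarrow> real \<times> real) \<Rightarrow> bool" where
  "geometric_braid n b \<longleftrightarrow>
     (\<forall>i\<in>{1..n}. continuous_on {0..1} (b i) \<and> (\<forall>t\<in>{0..1}. 0 < fst (b i t)) \<and> b i 0 = (real i, 0)) \<and>
     (\<lambda>i. b i 1) ` {1..n} = (\<lambda>i. (real i, 0)) ` {1..n} \<and>
     (\<forall>t\<in>{0..1}. inj_on (\<lambda>i. b i t) {1..n})"

text \<open>
  The levels \<open>t = 0\<close> and \<open>t = 1\<close> are glued by bending the braid once around the third axis:
  \<open>(x, z)\<close> at level \<open>t\<close> becomes the point with cylindrical coordinates \<open>(x, 2\<pi>t, z)\<close>.
  The frame (\<open>x\<close>, \<open>t\<close>, \<open>z\<close>) is right-handed, so a strand with increasing \<open>x\<close> passing above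
  (larger \<open>z\<close>) one with decreasing \<open>x\<close> gives a positive crossing.
\<close>

definition braid_closure :: "nat \<Rightarrow> (nat \<Rightarrow> real \<Rightarrow> real \<times> real) \<Rightarrow> (real^3) set" where
  "braid_closure n b =
     (\<Union>i\<in>{1..n}. (\<lambda>t. vector [fst (b i t) * cos (2 * pi * t),
                               fst (b i t) * sin (2 * pi * t),
                               snd (b i t)]) ` {0..1})"


section \<open>Lorenz braids\<close>

text \<open>The entry \<open>d\<^sub>i\<close> of a defining vector is \<open>d ! (i - 1)\<close>.\<close>

definition lorenz_vector :: "nat list \<Rightarrow> bool" where
  "lorenz_vector d \<longleftrightarrow> d \<noteq> [] \<and> sorted d \<and> (\<forall>x\<in>set d. 1 \<le> x)"

definition lorenz_width :: "nat list \<Rightarrow> nat" where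
  "lorenz_width d = length d + last d"

definition over_ends :: "nat list \<Rightarrow> nat set" where
  "over_ends d = (\<lambda>i. i + d ! (i - 1)) ` {1..length d}"

definition lorenz_end :: "nat list \<Rightarrow> nat \<Rightarrow> nat" where
  "lorenz_end d i =
     (if i \<le> length d then i + d ! (i - 1)
      else sorted_list_of_set ({1..lorenz_width d} - over_ends d) ! (i - length d - 1))"

text \<open>
  All strands project to straight segments, so that two of them cross at most once; two
  overcrossing strands never cross and neither do two undercrossing ones. Overcrossing strands
  are raised to height \<open>t(1 - t)\<close> above the undercrossing ones, which stay at height \<open>0\<close>.
\<close>

definition lorenz_braid :: "nat list \<Rightarrow> nat \<Rightarrow> real \<Rightarrow> real \<times> real" where
  "lorenz_braid d i t =
     ((1 - t) * real i + t * real (lorenz_end d i),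
      if i \<le> length d then t * (1 - t) else 0)"

lemma lorenz_braid_is_geometric_braid:
  assumes "lorenz_vector d"
  shows "geometric_braid (lorenz_width d) (lorenz_braid d)"
proof -
  let ?p = "length d" and ?N = "lorenz_width d" and ?e = "lorenz_end d"
  let ?U = "{1..?N} - over_ends d"
  have ne: "d \<noteq> []" and so: "sorted d" and pos: "\<forall>x\<in>set d. 1 \<le> x"
    using assms by (auto simp: lorenz_vector_def)
  have mono: "i + d ! (i - 1) < j + d ! (j - 1)" if "1 \<le> i" "i < j" "j \<le> ?p" for i j
  proof -
    have "d ! (i - 1) \<le> d ! (j - 1)"
      using that by (intro sorted_nth_mono[OF so]) auto
    with that show ?thesis by linarith
  qed
  have sub: "over_ends d \<subseteq> {1..?N}"
  proof -
    have "i + d ! (i - 1) \<le> ?N" if "1 \<le> i" "i \<le> ?p" for i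
    proof -
      have "d ! (i - 1) \<le> d ! (?p - 1)"
        using that by (intro sorted_nth_mono[OF so]) auto
      with that ne show ?thesis by (simp add: lorenz_width_def last_conv_nth)
    qed
    then show ?thesis by (auto simp: over_ends_def)
  qed
  have inj_over: "inj_on (\<lambda>i. i + d ! (i - 1)) {1..?p}"
    using mono by (intro linorder_inj_onI) (auto dest: less_imp_neq)
  then have "card (over_ends d) = ?p"
    by (simp add: over_ends_def card_image)
  then have cardU: "card ?U = last d"
    using sub by (subst card_Diff_subset) (auto simp: lorenz_width_def intro: finite_subset)
  have end_over: "?e i = i + d ! (i - 1)" if "i \<le> ?p" for i
    using that by (simp add: lorenz_end_def)
  have end_under: "?e i = sorted_list_of_set ?U ! (i - ?p - 1)" if "?p < i" for i
    using that by (simp add: lorenz_end_def)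
  have memU: "?e i \<in> ?U" if "?p < i" "i \<le> ?N" for i
  proof -
    have "i - ?p - 1 < length (sorted_list_of_set ?U)"
      using that cardU by (simp add: lorenz_width_def)
    then show ?thesis
      unfolding end_under[OF that(1)]
      by (metis nth_mem set_sorted_list_of_set finite_Diff finite_atLeastAtMost)
  qed
  have memO: "?e i \<in> over_ends d" if "1 \<le> i" "i \<le> ?p" for i
    using that by (auto simp: end_over over_ends_def)
  have monoU: "?e i < ?e j" if "?p < i" "i < j" "j \<le> ?N" for i j
  proof -
    have "j - ?p - 1 < length (sorted_list_of_set ?U)"
      using that cardU by (simp add: lorenz_width_def)
    moreover have "i - ?p - 1 < j - ?p - 1" using that by linarith
    ultimately show ?thesis
      unfolding end_under[OF that(1)] end_under[OF order.strict_trans[OF that(1,2)]]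
      using strict_sorted_list_of_set[of ?U] sorted_wrt_nth_less by blast
  qed
  have same: "?e i < ?e j"
    if "1 \<le> i" "i < j" "j \<le> ?N" "i \<le> ?p \<longleftrightarrow> j \<le> ?p" for i j
    using that mono monoU[of i j] by (cases "j \<le> ?p") (auto simp: end_over)
  have neq: "?e i \<noteq> ?e j" if "1 \<le> i" "i < j" "j \<le> ?N" for i j
  proof (cases "i \<le> ?p \<longleftrightarrow> j \<le> ?p")
    case True
    then show ?thesis using same[OF that] by simp
  next
    case False
    then have "i \<le> ?p" "?p < j" using that by auto
    then have "?e i \<in> over_ends d" "?e j \<in> ?U"
      using that memO[of i] memU[of j] by blast+
    then show ?thesis by auto
  qed
  have inj_end: "inj_on ?e {1..?N}"
    using neq by (intro linorder_inj_onI) auto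
  have "?e ` {1..?N} \<subseteq> {1..?N}"
  proof (rule image_subsetI)
    fix i assume i: "i \<in> {1..?N}"
    show "?e i \<in> {1..?N}"
    proof (cases "i \<le> ?p")
      case True
      then have "?e i \<in> over_ends d" using i by (intro memO) auto
      with sub show ?thesis by blast
    next
      case False
      then have "?e i \<in> ?U" using i by (intro memU) auto
      then show ?thesis by blast
    qed
  qed
  then have surj: "?e ` {1..?N} = {1..?N}"
    using inj_end by (simp add: endo_inj_surj)
  have x_pos: "0 < (1 - t) * real i + t * real (?e i)" if "i \<in> {1..?N}" "t \<in> {0..1}" for i t
  proof -
    have "?e i \<in> {1..?N}" using surj that(1) by blast
    then have "1 \<le> real (?e i)" "1 \<le> real i" using that(1) by simp_all
    then have "(1 - t) * 1 + t * 1 \<le> (1 - t) * real i + t * real (?e i)"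
      using that by (intro add_mono mult_left_mono) auto
    then show ?thesis by simp
  qed
  have disj: "lorenz_braid d i t \<noteq> lorenz_braid d j t"
    if "1 \<le> i" "i < j" "j \<le> ?N" "t \<in> {0..1}" for i j t
  proof (cases "i \<le> ?p \<longleftrightarrow> j \<le> ?p")
    case True
    have "real i < real j" "real (?e i) < real (?e j)"
      using same[OF that(1-3) True] that by auto
    then have "(1 - t) * real i + t * real (?e i) < (1 - t) * real j + t * real (?e j)"
      using that by (cases "t = 0")
        (auto intro!: add_le_less_mono mult_left_mono mult_strict_left_mono)
    then show ?thesis by (simp add: lorenz_braid_def)
  next
    case False
    then show ?thesis
      using that neq[OF that(1-3)] by (auto simp: lorenz_braid_def)
  qed
  have "(\<lambda>i. lorenz_braid d i 1) ` {1..?N} = (\<lambda>i. (real i, 0)) ` (?e ` {1..?N})"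
    unfolding image_image by (rule image_cong) (auto simp: lorenz_braid_def)
  moreover have "inj_on (\<lambda>i. lorenz_braid d i t) {1..?N}" if "t \<in> {0..1}" for t
    using disj that by (intro linorder_inj_onI) auto
  moreover have "continuous_on {0..1} (lorenz_braid d i)" for i
    unfolding lorenz_braid_def by (cases "i \<le> ?p") (auto intro!: continuous_intros)
  ultimately show ?thesis
    using x_pos surj by (auto simp: geometric_braid_def lorenz_braid_def)
qed

definition lorenz_link :: "nat list \<Rightarrow> (real^3) set" where
  "lorenz_link d = braid_closure (lorenz_width d) (lorenz_braid d)"

text \<open>\<open>power_vector r s m\<close> is the vector with \<open>r\<^sub>i\<close> repeated \<open>s\<^sub>i\<close> times for \<open>i = 1, \<dots>, m\<close>.\<close>

definition power_vector :: "(nat \<Rightarrow> nat) \<Rightarrow> (nat \<Rightarrow> nat) \<Rightarrow> nat \<Rightarrow> nat list" where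
  "power_vector r s m = concat (map (\<lambda>i. replicate (s i) (r i)) [1..<Suc m])"

end

theory Submission
  imports Defs
begin

text \<open>
  Since \<open>s\<^sub>i = n\<^sub>i r\<^sub>i\<close> for \<open>i < k\<close>, the common part of the two vectors is a sequence of square blocks
  \<open>w\<^sup>w\<close> with weakly increasing widths \<open>w\<close>, none of them larger than \<open>r = r\<^sub>k\<close> or \<open>s = s\<^sub>k\<close>. The closed
  braid then has a simple shape. The vector \<open>\<langle>r\<^sup>s\<rangle>\<close> alone gives a torus link; the blocks make the
  leftmost strands of this torus link run as a ribbon of parallel strands \<open>a = 1, 2, \<dots>\<close> some extra
  times around the axis, strand \<open>a\<close> once for each block of width at least \<open>a\<close>. The ribbon arrives
  from the right below everything else, goes at once to the place nearest to the axis, and spirals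
  outward above everything that it meets.

  A half turn of space about the line of positions reverses the direction of all strands and
  exchanges over and under. It turns the torus part \<open>\<langle>r\<^sup>s\<rangle>\<close> into \<open>\<langle>s\<^sup>r\<rangle>\<close> and leaves the ribbon on the
  leftmost positions, because no block is wider than \<open>r\<close> or \<open>s\<close>. So after the half turn, the
  closure of the first braid differs from that of the second only in the ribbon: it now spirals
  inward, below everything that it meets, and leaves at once above everything else.

  The inward and the outward spiral are isotopic, since in both the ribbon may be lifted so that
  its height increases along its whole course. The height alone then keeps different turns of the
  ribbon apart, and the distances from the axis can be changed at will. This gives three
  straight-line homotopies: \<open>raise_inward_strands\<close> lifts the inward spiral, \<open>unwind_strands\<close> makes
  it an outward spiral, and \<open>flatten_outward_strands\<close> lowers this to the heights of a Lorenz braid.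
  The comparison of crossings becomes the statement that, for any two strands at any time, the
  same coordinate separates them in the same direction at the beginning and at the end of the
  homotopy.

  A straight-line homotopy of closed braids without collisions extends to an isotopy of space
  (\<open>linear_isotopy\<close>): it is cut into steps so small that each can be performed by a map that, in
  every half-plane bounded by the axis, differs from the identity by a contraction.
\<close>

section \<open>Ambient isotopies\<close>

lemma isotopic_linksI:
  fixes F :: "real \<Rightarrow> real^3 \<Rightarrow> real^3"
  assumes cont: "continuous_on ({0..1} \<times> UNIV) (\<lambda>(s, P). F s P)"
    and homeo: "\<And>s. s \<in> {0..1} \<Longrightarrow> \<exists>g. homeomorphism UNIV UNIV (F s) g"
    and start: "\<And>P. F 0 P = P"
    and image: "F 1 ` K = L"
  shows "isotopic_links K L"
proof -
  have "homotopic_with_canon (\<lambda>f. \<exists>g. homeomorphism UNIV UNIV f g) UNIV UNIV id (F 1)"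
    unfolding homotopic_with_def
    by (rule exI[of _ "\<lambda>(s, P). F s P"])
      (use cont homeo start in \<open>auto simp: prod_topology_subtopology subtopology_UNIV simp flip: euclidean_product_topology\<close>)
  then show ?thesis
    unfolding isotopic_links_def using image by blast
qed

lemma isotopic_links_refl: "isotopic_links K K"
proof (rule isotopic_linksI[where F = "\<lambda>s P. P"])
  show "\<exists>g. homeomorphism UNIV UNIV (\<lambda>P::real^3. P) g"
    using homeomorphism_ident by blast
qed (auto simp: case_prod_beta intro: continuous_intros)

lemma isotopic_links_trans:
  assumes "isotopic_links K L" "isotopic_links L M"
  shows "isotopic_links K M"
proof -
  let ?P = "\<lambda>f::real^3 \<Rightarrow> real^3. \<exists>g. homeomorphism UNIV UNIV f g"
  obtain h1 where h1: "homotopic_with_canon ?P UNIV UNIV id h1" "h1 ` K = L"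
    using assms unfolding isotopic_links_def by blast
  obtain h2 where h2: "homotopic_with_canon ?P UNIV UNIV id h2" "h2 ` L = M"
    using assms unfolding isotopic_links_def by blast
  obtain g1 where g1: "homeomorphism UNIV UNIV h1 g1"
    using homotopic_with_imp_property[OF h1(1)] by blast
  have "homotopic_with_canon (\<lambda>f. ?P (f \<circ> h1)) UNIV UNIV id h2"
    using h2(1) by (rule homotopic_with_mono) (use g1 homeomorphism_compose in blast)
  then have "homotopic_with_canon ?P UNIV UNIV (id \<circ> h1) (h2 \<circ> h1)"
    by (rule homotopic_with_compose_continuous_right) (use g1 homeomorphism_cont1 in auto)
  then have "homotopic_with_canon ?P UNIV UNIV id (h2 \<circ> h1)"
    using h1(1) homotopic_with_trans by force
  moreover have "(h2 \<circ> h1) ` K = M" using h1 h2 by (auto simp: image_comp[symmetric])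
  ultimately show ?thesis unfolding isotopic_links_def by blast
qed


section \<open>Cylindrical coordinates\<close>

definition cyl :: "real \<Rightarrow> real \<times> real \<Rightarrow> real^3" where
  "cyl t y = vector [fst y * cos (2 * pi * t), fst y * sin (2 * pi * t), snd y]"

lemma cyl_nth [simp]:
  "cyl t y $ 1 = fst y * cos (2 * pi * t)"
  "cyl t y $ 2 = fst y * sin (2 * pi * t)"
  "cyl t y $ 3 = snd y"
  by (simp_all add: cyl_def)

lemma vec3_eq_iff: "(P::real^3) = P' \<longleftrightarrow> P $ 1 = P' $ 1 \<and> P $ 2 = P' $ 2 \<and> P $ 3 = P' $ 3"
  by (simp add: vec_eq_iff forall_3)

lemma cyl_eqD:
  assumes eq: "cyl t y = cyl t' y'" and nonneg: "0 \<le> fst y" "0 \<le> fst y'"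
  shows "y = y'"
proof -
  have sq: "(fst z)\<^sup>2 = (cyl u z $ 1)\<^sup>2 + (cyl u z $ 2)\<^sup>2" for z u
    by (simp add: power_mult_distrib flip: distrib_left)
  have "(fst y)\<^sup>2 = (fst y')\<^sup>2" using sq[of y t] sq[of y' t'] eq by simp
  then have "fst y = fst y'" using nonneg by (simp add: power2_eq_iff_nonneg)
  moreover have "snd y = snd y'" using eq by (metis cyl_nth(3))
  ultimately show ?thesis by (simp add: prod_eq_iff)
qed

lemma cyl_eq_angleD:
  assumes eq: "cyl t y = cyl t' y'" and pos: "0 < fst y" "0 < fst y'"
    and t: "t \<in> {0..1}" "t' \<in> {0..1}"
  shows "t = t' \<or> t = 0 \<and> t' = 1 \<or> t = 1 \<and> t' = 0"
proof -
  have "y = y'" using cyl_eqD[OF eq] pos by simp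
  then have "cos (2 * pi * t) = cos (2 * pi * t') \<and> sin (2 * pi * t) = sin (2 * pi * t')"
    using eq pos by (auto simp: vec3_eq_iff)
  then obtain n :: int where n: "2 * pi * t = 2 * pi * t' + 2 * pi * of_int n"
    using sin_cos_eq_iff by metis
  then have "2 * pi * (t - t' - of_int n) = 0" by (simp add: algebra_simps)
  then have tn: "t - t' = of_int n" by simp
  then have "real_of_int n \<le> 1" "- 1 \<le> real_of_int n" using t by auto
  then have "n = -1 \<or> n = 0 \<or> n = 1" by linarith
  then show ?thesis using tn t by auto
qed

definition radius :: "real^3 \<Rightarrow> real" where
  "radius P = sqrt ((P $ 1)\<^sup>2 + (P $ 2)\<^sup>2)"

text \<open>
  The angle, measured in full turns. It jumps from \<open>1\<close> to \<open>0\<close> across the positive first axis, but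
  its restrictions to the two closed half-spaces \<open>0 \<le> P $ 2\<close> and \<open>P $ 2 \<le> 0\<close> off the third axis extend
  continuously; the two formulas are for these half-spaces.
\<close>
definition turn :: "real^3 \<Rightarrow> real" where
  "turn P = (if 0 \<le> P $ 2 then arccos (P $ 1 / radius P) / (2 * pi)
             else 1 - arccos (P $ 1 / radius P) / (2 * pi))"

lemma radius_nonneg [simp]: "0 \<le> radius P"
  by (simp add: radius_def)

lemma radius_ratio: "- 1 \<le> P $ 1 / radius P \<and> P $ 1 / radius P \<le> 1"
proof -
  have "\<bar>P $ 1\<bar> \<le> radius P"
    unfolding radius_def by (rule real_le_rsqrt) simp
  then have "\<bar>P $ 1 / radius P\<bar> \<le> 1"
    by (cases "radius P = 0") (simp_all add: abs_divide less_le)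
  then show ?thesis by linarith
qed

lemma turn_range: "turn P \<in> {0..1}"
proof -
  have "0 \<le> arccos (P $ 1 / radius P)" "arccos (P $ 1 / radius P) \<le> pi"
    using arccos_bounded radius_ratio by blast+
  then show ?thesis by (simp add: turn_def field_simps)
qed

lemma cyl_turn: "cyl (turn P) (radius P, P $ 3) = P"
proof (cases "radius P = 0")
  case True
  then have "P $ 1 = 0" "P $ 2 = 0" by (simp_all add: radius_def sum_power2_eq_zero_iff)
  with True show ?thesis by (simp add: vec3_eq_iff)
next
  case False
  then have pos: "0 < radius P" using radius_nonneg[of P] by linarith
  let ?u = "P $ 1 / radius P"
  let ?A = "arccos ?u"
  have u: "- 1 \<le> ?u" "?u \<le> 1" using radius_ratio by auto
  have sq: "(radius P)\<^sup>2 = (P $ 1)\<^sup>2 + (P $ 2)\<^sup>2" by (simp add: radius_def)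
  have "?u\<^sup>2 + (P $ 2 / radius P)\<^sup>2 = (radius P)\<^sup>2 / (radius P)\<^sup>2"
    by (simp only: power_divide add_divide_distrib[symmetric] sq[symmetric])
  then have "1 - ?u\<^sup>2 = (P $ 2 / radius P)\<^sup>2" using pos by simp
  then have sin: "sin ?A = \<bar>P $ 2\<bar> / radius P"
    using u pos by (simp add: sin_arccos abs_divide)
  have cos: "cos ?A = ?u" using u by (rule cos_arccos)
  show ?thesis
  proof (cases "0 \<le> P $ 2")
    case True
    then have "2 * pi * turn P = ?A" by (simp add: turn_def)
    then show ?thesis using sin cos pos True by (simp add: vec3_eq_iff)
  next
    case False
    then have "2 * pi * turn P = 2 * pi - ?A" by (simp add: turn_def field_simps)
    then show ?thesis using sin cos pos False by (simp add: vec3_eq_iff)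
  qed
qed

lemma exists_cyl: obtains t y where "P = cyl t y" "t \<in> {0..1}" "0 \<le> fst y"
  using cyl_turn[of P] turn_range[of P] by (metis fst_conv radius_nonneg)

lemma continuous_on_cyl [continuous_intros]:
  fixes S :: "'a::t2_space set"
  assumes "continuous_on S f" "continuous_on S g"
  shows "continuous_on S (\<lambda>x. cyl (f x) (g x))"
proof -
  have "cyl t y = (fst y * cos (2 * pi * t)) *\<^sub>R axis 1 1 + (fst y * sin (2 * pi * t)) *\<^sub>R axis 2 1
      + snd y *\<^sub>R axis 3 1" for t y
    by (simp add: vec3_eq_iff axis_def)
  then show ?thesis by (simp only:) (intro continuous_intros assms)
qed


section \<open>Isotopies that preserve the half-planes bounded by the axis\<close>

text \<open>
  In the half-plane at angle \<open>t\<close> the isotopy is \<open>y \<mapsto> y + s g(t, y)\<close>, \<open>0 \<le> s \<le> 1\<close>. As \<open>g(t, \<cdot>)\<close> is a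
  contraction, this map is injective, and it is surjective by the fixed point theorem of Banach; as
  \<open>g\<close> vanishes near the axis, the half-planes fit together to a bijection of space. Its inverse is
  continuous by invariance of domain.
\<close>
lemma fibrewise_isotopy:
  fixes g :: "real \<Rightarrow> real \<times> real \<Rightarrow> real \<times> real"
  assumes cont: "continuous_on ({0..1} \<times> UNIV) (\<lambda>(t, y). g t y)"
    and glue: "\<And>y. g 0 y = g 1 y"
    and off: "\<And>t y. t \<in> {0..1} \<Longrightarrow> fst y \<le> d \<Longrightarrow> g t y = 0" and "0 < d"
    and contr: "\<And>t y y'. t \<in> {0..1} \<Longrightarrow> norm (g t y - g t y') \<le> L * norm (y - y')"
    and L: "0 \<le> L" "L < 1"
    and K: "K = (\<Union>i\<in>I. (\<lambda>t. cyl t (b i t)) ` {0..1})"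
    and K': "K' = (\<Union>i\<in>I. (\<lambda>t. cyl t (b i t + g t (b i t))) ` {0..1})"
    and pos: "\<And>i t. i \<in> I \<Longrightarrow> t \<in> {0..1} \<Longrightarrow> 0 < fst (b i t)"
  shows "isotopic_links K K'"
proof -
  define F where "F s P = (let y = (radius P, P $ 3) in cyl (turn P) (y + s *\<^sub>R g (turn P) y))" for s P
  have g_axis: "g t y = 0" if "t \<in> {0..1}" "fst y = 0" for t y
    using off[of t y] that \<open>0 < d\<close> by simp
  have stretch: "0 < fst (y + s *\<^sub>R g t y)" if "t \<in> {0..1}" "s \<in> {0..1}" "0 < fst y" for s t y
  proof -
    \<comment> \<open>Compare with the point of the axis at the same height, which does not move.\<close>
    have "norm (g t y - g t (0, snd y)) \<le> L * norm (y - (0, snd y))" by (rule contr[OF that(1)])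
    moreover have "norm (y - (0, snd y)) = fst y" using that by (simp add: norm_prod_def fst_diff snd_diff)
    moreover have "g t (0, snd y) = 0" using g_axis[OF that(1)] by simp
    ultimately have "norm (g t y) \<le> L * fst y" by simp
    moreover have "\<bar>fst (g t y)\<bar> \<le> norm (g t y)" using norm_fst_le[of "fst (g t y)" "snd (g t y)"] by simp
    moreover have "L * fst y < fst y" using L that by simp
    ultimately have "\<bar>fst (g t y)\<bar> < fst y" by linarith
    moreover have "s * \<bar>fst (g t y)\<bar> \<le> 1 * \<bar>fst (g t y)\<bar>" by (rule mult_right_mono) (use that in auto)
    moreover have "s * \<bar>fst (g t y)\<bar> = \<bar>s * fst (g t y)\<bar>" using that by (simp add: abs_mult)
    ultimately show ?thesis by simp
  qed
  have stretch0: "0 \<le> fst (y + s *\<^sub>R g t y)" if "t \<in> {0..1}" "s \<in> {0..1}" "0 \<le> fst y" for s t y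
  proof (cases "fst y = 0")
    case True
    then show ?thesis using g_axis[OF that(1)] by simp
  next
    case False
    then show ?thesis using stretch[OF that(1,2), of y] that(3) by linarith
  qed
  have axis_iff: "fst (y + s *\<^sub>R g t y) = 0 \<longleftrightarrow> fst y = 0"
    if "t \<in> {0..1}" "s \<in> {0..1}" "0 \<le> fst y" for s t y
  proof (cases "fst y = 0")
    case True
    then show ?thesis using g_axis[OF that(1)] by simp
  next
    case False
    then show ?thesis using stretch[OF that(1,2), of y] that(3) by linarith
  qed
  have F_cyl: "F s (cyl t y) = cyl t (y + s *\<^sub>R g t y)" if "t \<in> {0..1}" "0 \<le> fst y" for s t y
  proof -
    let ?P = "cyl t y"
    have eq: "cyl (turn ?P) (radius ?P, ?P $ 3) = cyl t y" by (rule cyl_turn)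
    have y: "(radius ?P, ?P $ 3) = y" by (rule cyl_eqD[OF eq]) (use that in auto)
    show ?thesis
    proof (cases "fst y = 0")
      case True
      then show ?thesis
        using eq that turn_range[of ?P] unfolding F_def y Let_def by (simp add: g_axis)
    next
      case False
      then have "0 < fst y" using that by simp
      have eq': "cyl (turn ?P) y = cyl t y" using eq unfolding y .
      then consider "turn ?P = t" | "turn ?P = 0" "t = 1" | "turn ?P = 1" "t = 0"
        using cyl_eq_angleD[OF eq' \<open>0 < fst y\<close> \<open>0 < fst y\<close> turn_range \<open>t \<in> {0..1}\<close>] by blast
      then have "g (turn ?P) y = g t y" and "cyl (turn ?P) z = cyl t z" for z
        by (cases; auto simp: glue vec3_eq_iff)+
      then show ?thesis unfolding F_def y Let_def by (simp only:)
    qed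
  qed
  have inj: "inj (F s)" if s: "s \<in> {0..1}" for s
  proof (rule injI)
    fix P P' assume FF: "F s P = F s P'"
    obtain t y where P: "P = cyl t y" and t: "t \<in> {0..1}" and y: "0 \<le> fst y" by (rule exists_cyl)
    obtain t' y' where P': "P' = cyl t' y'" and t': "t' \<in> {0..1}" and y': "0 \<le> fst y'"
      by (rule exists_cyl)
    have eq: "cyl t (y + s *\<^sub>R g t y) = cyl t' (y' + s *\<^sub>R g t' y')"
      using FF P P' F_cyl t t' y y' by simp
    then have yy: "y + s *\<^sub>R g t y = y' + s *\<^sub>R g t' y'"
      by (rule cyl_eqD) (use stretch0 s t t' y y' in blast)+
    show "P = P'"
    proof (cases "fst y = 0 \<or> fst y' = 0")
      case True
      then have "fst y = 0 \<and> fst y' = 0"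
        using axis_iff[OF t s y] axis_iff[OF t' s y'] unfolding yy by blast
      moreover have "y = y'" using yy g_axis t t' calculation by simp
      ultimately show ?thesis using P P' by (simp add: vec3_eq_iff)
    next
      case False
      then have pos: "0 < fst y" "0 < fst y'" using y y' by auto
      then have tt: "t = t' \<or> t = 0 \<and> t' = 1 \<or> t = 1 \<and> t' = 0"
        using cyl_eq_angleD[OF eq] stretch s t t' by blast
      then have "g t' y' = g t y'" using glue[of y'] by (elim disjE conjE) (simp_all only:)
      then have "y - y' = s *\<^sub>R (g t y' - g t y)" using yy by (simp add: algebra_simps)
      then have "norm (y - y') = s * norm (g t y' - g t y)" using s by simp
      also have "\<dots> \<le> 1 * norm (g t y' - g t y)" by (rule mult_right_mono) (use s in auto)
      also have "\<dots> \<le> L * norm (y - y')" using contr[OF t, of y' y] by (simp add: norm_minus_commute)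
      finally have "(1 - L) * norm (y - y') \<le> 0" by (simp add: algebra_simps)
      then have "norm (y - y') \<le> 0" using L by (simp add: mult_le_0_iff)
      then have "y = y'" by simp
      moreover have "cyl t y = cyl t' y" using tt by (auto simp: vec3_eq_iff)
      ultimately show ?thesis using P P' by simp
    qed
  qed
  have surj: "F s ` UNIV = UNIV" if s: "s \<in> {0..1}" for s
  proof -
    have "\<exists>P. P' = F s P" for P'
    proof -
      obtain t y' where P': "P' = cyl t y'" and t: "t \<in> {0..1}" and y': "0 \<le> fst y'" by (rule exists_cyl)
      have "dist (y' - s *\<^sub>R g t u) (y' - s *\<^sub>R g t v) \<le> L * dist u v" for u v
      proof -
        have "dist (y' - s *\<^sub>R g t u) (y' - s *\<^sub>R g t v) = s * norm (g t u - g t v)"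
          using s by (simp add: dist_norm norm_minus_commute flip: scaleR_diff_right)
        also have "\<dots> \<le> 1 * norm (g t u - g t v)" by (rule mult_right_mono) (use s in auto)
        also have "\<dots> \<le> L * dist u v" using contr[OF t] by (simp add: dist_norm)
        finally show ?thesis .
      qed
      then obtain y where y: "y' - s *\<^sub>R g t y = y"
        using banach_fix_type[OF L, of "\<lambda>u. y' - s *\<^sub>R g t u"] by blast
      have "0 \<le> fst y"
      proof (rule ccontr)
        assume "\<not> 0 \<le> fst y"
        then have "g t y = 0" using off[OF t, of y] \<open>0 < d\<close> by simp
        then show False using y y' \<open>\<not> 0 \<le> fst y\<close> by simp
      qed
      then have "F s (cyl t y) = cyl t (y + s *\<^sub>R g t y)" using F_cyl t by simp
      also have "y + s *\<^sub>R g t y = y'" using y by (metis diff_add_cancel)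
      finally show ?thesis using P' by metis
    qed
    then show ?thesis by auto
  qed
  have F_near: "F s P = P" if "radius P < d" for s P
    using off[OF turn_range[of P], of "(radius P, P $ 3)"] that cyl_turn[of P] by (simp add: F_def)
  have rad_cont: "continuous_on S radius" for S
    unfolding radius_def by (intro continuous_intros)
  have Fcont: "continuous_on ({0..1} \<times> UNIV) (\<lambda>(s, P). F s P)"
  proof -
    define \<alpha> where "\<alpha> P = arccos (P $ 1 / radius P) / (2 * pi)" for P
    define H where "H t s P = cyl t ((radius P, P $ 3) + s *\<^sub>R g t (radius P, P $ 3))" for t s P
    have \<alpha>_range: "\<alpha> P \<in> {0..1}" for P
      using arccos_bounded[of "P $ 1 / radius P"] radius_ratio[of P] by (simp add: \<alpha>_def field_simps)
    let ?A = "{0..1} \<times> {P. 0 < radius P}" and ?B = "{0..1} \<times> {P. radius P < d}"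
    have \<alpha>_cont: "continuous_on S (\<lambda>x. \<alpha> (snd x))" if "S \<subseteq> ?A" for S
      unfolding \<alpha>_def
      by (intro continuous_intros continuous_on_compose2[OF rad_cont[of UNIV]])
        (use that radius_ratio in \<open>auto simp: less_le\<close>)
    have H_cont: "continuous_on S (\<lambda>x. H (f x) (fst x) (snd x))"
      if f: "continuous_on S f" "\<And>x. x \<in> S \<Longrightarrow> f x \<in> {0..1}" for S f
      unfolding H_def
      by (intro continuous_intros f(1) continuous_on_compose2[OF rad_cont[of UNIV]]
           continuous_on_compose2[OF cont, of S "\<lambda>x. (f x, (radius (snd x), snd x $ 3))", simplified])
        (use f(2) in auto)
    \<comment> \<open>The half-spaces meet at the angles \<open>0\<close> and \<open>1\<close>, where \<open>g\<close> is glued, and at \<open>1 / 2\<close>.\<close>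
    have join: "H (\<alpha> P) s P = H (1 - \<alpha> P) s P" if "0 < radius P" "P $ 2 = 0" for s P
    proof -
      have "radius P = \<bar>P $ 1\<bar>" using that by (simp add: radius_def)
      then have "P $ 1 / radius P = 1 \<or> P $ 1 / radius P = - 1"
        using that(1) by (auto simp: abs_if split: if_splits)
      then show ?thesis
        by (auto simp: \<alpha>_def H_def glue vec3_eq_iff)
    qed
    have "continuous_on ?A (\<lambda>x. if - (snd x $ 2) \<le> 0 then H (\<alpha> (snd x)) (fst x) (snd x)
        else H (1 - \<alpha> (snd x)) (fst x) (snd x))"
      by (intro continuous_on_cases_le H_cont \<alpha>_cont continuous_intros)
        (use join \<alpha>_range in auto)
    moreover have "F s P = (if - (P $ 2) \<le> 0 then H (\<alpha> P) s P else H (1 - \<alpha> P) s P)" for s P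
      by (simp add: F_def H_def turn_def \<alpha>_def Let_def)
    ultimately have A: "continuous_on ?A (\<lambda>(s, P). F s P)"
      by (simp add: case_prod_beta)
    have B: "continuous_on ?B (\<lambda>(s, P). F s P)"
      by (rule continuous_on_eq[where f = snd]) (auto intro: continuous_intros simp: F_near)
    have "open {P. 0 < radius P}" "open {P. radius P < d}"
      by (auto intro!: open_Collect_less rad_cont continuous_intros)
    then have "openin (top_of_set ({0..1} \<times> UNIV)) ?A" "openin (top_of_set ({0..1} \<times> UNIV)) ?B"
      by (auto intro!: openin_Times simp: openin_open_eq)
    moreover have "{0..1} \<times> UNIV = ?A \<union> ?B"
      using \<open>0 < d\<close> radius_nonneg by (fastforce simp: less_le)
    ultimately show ?thesis
      using A B by (metis continuous_on_Un_local_open)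
  qed
  have homeo: "\<exists>g. homeomorphism UNIV UNIV (F s) g" if s: "s \<in> {0..1}" for s
  proof -
    have "continuous_on UNIV ((\<lambda>(s, P). F s P) \<circ> Pair s)"
      by (rule continuous_on_compose) (use s in \<open>auto intro!: continuous_intros continuous_on_subset[OF Fcont]\<close>)
    then have "continuous_on UNIV (F s)" by (simp add: comp_def)
    then obtain g where "homeomorphism UNIV (F s ` UNIV) (F s) g"
      by (rule invariance_of_domain_homeomorphism[OF open_UNIV _ order_refl inj[OF s]])
    then show ?thesis unfolding surj[OF s] by blast
  qed
  have "F 1 ` K = K'"
    unfolding K K' image_UN image_image
    by (intro SUP_cong image_cong refl) (use pos in \<open>simp add: F_cyl less_imp_le\<close>)
  moreover have "F 0 P = P" for P using cyl_turn[of P] by (simp add: F_def)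
  ultimately show ?thesis
    using isotopic_linksI[of F K K'] Fcont homeo by blast
qed


section \<open>Straight-line homotopies of closed braids\<close>

definition closed_curves :: "'i set \<Rightarrow> ('i \<Rightarrow> real \<Rightarrow> real \<times> real) \<Rightarrow> (real^3) set" where
  "closed_curves I b = (\<Union>i\<in>I. (\<lambda>t. cyl t (b i t)) ` {0..1})"

lemma lorenz_link_closed_curves: "lorenz_link d = closed_curves {1..lorenz_width d} (lorenz_braid d)"
  by (simp add: lorenz_link_def braid_closure_def closed_curves_def cyl_def)

lemma closed_curves_image: "closed_curves (f ` I) b = closed_curves I (\<lambda>i. b (f i))"
  by (simp add: closed_curves_def)

lemma closed_curves_cong:
  assumes "\<And>i t. i \<in> I \<Longrightarrow> t \<in> {0..1} \<Longrightarrow> b i t = b' i t"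
  shows "closed_curves I b = closed_curves I b'"
  unfolding closed_curves_def using assms by (intro SUP_cong image_cong refl) simp

text \<open>
  The push is the sum of tent functions around the strands, each times the displacement of its
  strand. The tents have radius \<open>\<delta>\<close>, so each strand feels only its own tent and moves by exactly
  \<open>v i t\<close>, and each tent has slope \<open>1 / \<delta>\<close>, so the displacement is a contraction if \<open>v\<close> is small.
\<close>
lemma push_isotopy:
  fixes c v :: "'i \<Rightarrow> real \<Rightarrow> real \<times> real"
  assumes fin: "finite I"
    and cont: "\<And>i. i \<in> I \<Longrightarrow> continuous_on {0..1} (c i)" "\<And>i. i \<in> I \<Longrightarrow> continuous_on {0..1} (v i)"
    and match: "\<And>i. i \<in> I \<Longrightarrow> \<exists>j\<in>I. c j 0 = c i 1 \<and> v j 0 = v i 1"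
    and gap: "\<And>i j t. i \<in> I \<Longrightarrow> j \<in> I \<Longrightarrow> i \<noteq> j \<Longrightarrow> t \<in> {0..1} \<Longrightarrow> \<delta> \<le> norm (c i t - c j t)"
    and off_axis: "\<And>i t. i \<in> I \<Longrightarrow> t \<in> {0..1} \<Longrightarrow> 2 * \<delta> \<le> fst (c i t)"
    and small: "\<And>i t. i \<in> I \<Longrightarrow> t \<in> {0..1} \<Longrightarrow> norm (v i t) \<le> \<epsilon>"
    and \<delta>: "0 < \<delta>" and \<epsilon>: "0 \<le> \<epsilon>" "real (card I) * \<epsilon> < \<delta>"
  shows "isotopic_links (closed_curves I c) (closed_curves I (\<lambda>i t. c i t + v i t))"
proof -
  define tent where "tent u = max 0 (1 - norm u / \<delta>)" for u :: "real \<times> real"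
  define g where "g t y = (\<Sum>i\<in>I. tent (y - c i t) *\<^sub>R v i t)" for t y
  have tent0: "tent u = 0" if "\<delta> \<le> norm u" for u
    using that \<delta> by (simp add: tent_def)
  have tent_lip: "\<bar>tent u - tent w\<bar> \<le> norm (u - w) / \<delta>" for u w
  proof -
    have "\<bar>tent u - tent w\<bar> \<le> \<bar>norm u / \<delta> - norm w / \<delta>\<bar>" unfolding tent_def by linarith
    also have "\<dots> = \<bar>norm u - norm w\<bar> / \<delta>" using \<delta> by (simp flip: diff_divide_distrib)
    also have "\<dots> \<le> norm (u - w) / \<delta>" using \<delta> by (intro divide_right_mono norm_triangle_ineq3) auto
    finally show ?thesis .
  qed
  have g_strand: "g t (c j t) = v j t" if "j \<in> I" "t \<in> {0..1}" for j t
  proof -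
    have "tent (c j t - c i t) *\<^sub>R v i t = (if i = j then v j t else 0)" if "i \<in> I" for i
      using gap[OF \<open>j \<in> I\<close> that] \<open>t \<in> {0..1}\<close> tent0 by (auto simp: tent_def)
    then have "g t (c j t) = (\<Sum>i\<in>I. if i = j then v j t else 0)" unfolding g_def by (intro sum.cong) auto
    then show ?thesis using fin that by simp
  qed
  have "isotopic_links (closed_curves I c) (\<Union>i\<in>I. (\<lambda>t. cyl t (c i t + g t (c i t))) ` {0..1})"
  proof (rule fibrewise_isotopy[where d = \<delta> and L = "real (card I) * \<epsilon> / \<delta>" and I = I and b = c])
    show "continuous_on ({0..1} \<times> UNIV) (\<lambda>(t, y). g t y)"
      unfolding g_def tent_def case_prod_beta
      by (intro continuous_intros continuous_on_compose2[OF cont(1)] continuous_on_compose2[OF cont(2)])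
        (use \<delta> in auto)
    show "g 0 y = g 1 y" for y
    proof -
      obtain \<pi> where \<pi>: "\<And>i. i \<in> I \<Longrightarrow> \<pi> i \<in> I \<and> c (\<pi> i) 0 = c i 1 \<and> v (\<pi> i) 0 = v i 1"
        using match by metis
      have "inj_on \<pi> I"
      proof (rule inj_onI, rule ccontr)
        fix i j assume ij: "i \<in> I" "j \<in> I" "\<pi> i = \<pi> j" "i \<noteq> j"
        then have "c i 1 = c j 1" using \<pi> by metis
        then show False using gap[OF ij(1,2,4), of 1] \<delta> by simp
      qed
      then have "bij_betw \<pi> I I"
        using \<pi> fin by (simp add: bij_betw_def endo_inj_surj image_subset_iff)
      then have "g 0 y = (\<Sum>i\<in>I. tent (y - c (\<pi> i) 0) *\<^sub>R v (\<pi> i) 0)"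
        unfolding g_def by (rule sum.reindex_bij_betw[symmetric])
      also have "\<dots> = g 1 y" unfolding g_def using \<pi> by (intro sum.cong) auto
      finally show ?thesis .
    qed
    show "g t y = 0" if "t \<in> {0..1}" "fst y \<le> \<delta>" for t y
      unfolding g_def
    proof (rule sum.neutral, intro ballI)
      fix i assume i: "i \<in> I"
      have "\<delta> \<le> \<bar>fst (y - c i t)\<bar>" using off_axis[OF i that(1)] that(2) by simp
      also have "\<dots> \<le> norm (y - c i t)"
        using norm_fst_le by (metis prod.collapse real_norm_def)
      finally show "tent (y - c i t) *\<^sub>R v i t = 0" using tent0 by simp
    qed
    show "norm (g t y - g t y') \<le> real (card I) * \<epsilon> / \<delta> * norm (y - y')" if t: "t \<in> {0..1}" for t y y'
    proof -
      have "norm (g t y - g t y') = norm (\<Sum>i\<in>I. (tent (y - c i t) - tent (y' - c i t)) *\<^sub>R v i t)"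
        by (simp add: g_def sum_subtractf scaleR_diff_left)
      also have "\<dots> \<le> (\<Sum>i\<in>I. norm (y - y') / \<delta> * \<epsilon>)"
      proof (rule sum_norm_le)
        fix i assume i: "i \<in> I"
        have "\<bar>tent (y - c i t) - tent (y' - c i t)\<bar> \<le> norm (y - y') / \<delta>"
          using tent_lip[of "y - c i t" "y' - c i t"] by simp
        then show "norm ((tent (y - c i t) - tent (y' - c i t)) *\<^sub>R v i t) \<le> norm (y - y') / \<delta> * \<epsilon>"
          using small[OF i t] \<delta> unfolding norm_scaleR real_norm_def
          by (intro mult_mono) auto
      qed
      finally show ?thesis by (simp add: ac_simps)
    qed
    show "0 < fst (c i t)" if "i \<in> I" "t \<in> {0..1}" for i t
      using off_axis[OF that] \<delta> by simp
  qed (use \<delta> \<epsilon> in \<open>auto simp: closed_curves_def\<close>)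
  also have "(\<Union>i\<in>I. (\<lambda>t. cyl t (c i t + g t (c i t))) ` {0..1}) = closed_curves I (\<lambda>i t. c i t + v i t)"
    unfolding closed_curves_def by (intro SUP_cong image_cong refl) (simp add: g_strand)
  finally show ?thesis .
qed

lemma uniform_lower_bound:
  fixes f :: "'a \<Rightarrow> 'b::topological_space \<Rightarrow> real"
  assumes "finite A" "compact S"
    and "\<And>a. a \<in> A \<Longrightarrow> continuous_on S (f a)" "\<And>a x. a \<in> A \<Longrightarrow> x \<in> S \<Longrightarrow> 0 < f a x"
  obtains \<delta> where "0 < \<delta>" "\<And>a x. a \<in> A \<Longrightarrow> x \<in> S \<Longrightarrow> \<delta> \<le> f a x"
proof -
  have "\<exists>\<delta>>0. \<forall>x\<in>S. \<delta> \<le> f a x" if a: "a \<in> A" for a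
  proof (cases "S = {}")
    case False
    then show ?thesis
      using continuous_attains_inf[OF \<open>compact S\<close> _ assms(3)[OF a]] assms(4)[OF a] by blast
  qed (auto intro: exI[of _ 1])
  then obtain d where d: "\<And>a. a \<in> A \<Longrightarrow> 0 < d a \<and> (\<forall>x\<in>S. d a \<le> f a x)" by metis
  show thesis
  proof
    show "0 < Min (insert 1 (d ` A))" using \<open>finite A\<close> d by auto
    show "Min (insert 1 (d ` A)) \<le> f a x" if "a \<in> A" "x \<in> S" for a x
      using d[OF that(1)] that \<open>finite A\<close> by (intro order_trans[OF Min_le[of _ "d a"]]) auto
  qed
qed

text \<open>
  One of the two coordinates separates \<open>p\<close> from \<open>q\<close> and \<open>p'\<close> from \<open>q'\<close> in the same direction. This is
  what keeps two points apart while they move uniformly from \<open>p\<close> to \<open>p'\<close> and from \<open>q\<close> to \<open>q'\<close>.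
\<close>
definition same_side :: "real \<times> real \<Rightarrow> real \<times> real \<Rightarrow> real \<times> real \<Rightarrow> real \<times> real \<Rightarrow> bool" where
  "same_side p q p' q' \<longleftrightarrow>
     0 < (fst p - fst q) * (fst p' - fst q') \<or> 0 < (snd p - snd q) * (snd p' - snd q')"

lemma same_side_imp_neq:
  assumes "same_side p q p' q'" and u: "0 \<le> u" "u \<le> 1"
  shows "p + u *\<^sub>R (p' - p) \<noteq> q + u *\<^sub>R (q' - q)"
proof -
  have pos: "0 < (1 - u) * x + u * y" if "0 < x" "0 < y" for x y :: real
    using u that by (cases "u = 0") (auto intro: add_nonneg_pos)
  have convex: "(1 - u) * x + u * y \<noteq> 0" if "0 < x * y" for x y :: real
    using that pos[of x y] pos[of "- x" "- y"] by (auto simp: zero_less_mult_iff)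
  show ?thesis
  proof
    assume eq: "p + u *\<^sub>R (p' - p) = q + u *\<^sub>R (q' - q)"
    have "(1 - u) * (fst p - fst q) + u * (fst p' - fst q') = 0"
      using arg_cong[OF eq, of fst] by (simp add: algebra_simps)
    moreover have "(1 - u) * (snd p - snd q) + u * (snd p' - snd q') = 0"
      using arg_cong[OF eq, of snd] by (simp add: algebra_simps)
    ultimately show False using assms(1) convex unfolding same_side_def by blast
  qed
qed

text \<open>
  By compactness, the strands keep a distance \<open>\<delta>\<close> from each other, and a distance \<open>2 \<delta>\<close> from the axis,
  during the whole homotopy. Hence the number of small pushes needed can be bounded in advance.
\<close>
lemma linear_isotopy:
  fixes b b' :: "'i \<Rightarrow> real \<Rightarrow> real \<times> real"
  assumes fin: "finite I"
    and cont: "\<And>i. i \<in> I \<Longrightarrow> continuous_on {0..1} (b i)" "\<And>i. i \<in> I \<Longrightarrow> continuous_on {0..1} (b' i)"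
    and match: "\<And>i. i \<in> I \<Longrightarrow> \<exists>j\<in>I. b j 0 = b i 1 \<and> b' j 0 = b' i 1"
    and pos: "\<And>i t. i \<in> I \<Longrightarrow> t \<in> {0..1} \<Longrightarrow> 0 < fst (b i t)"
      "\<And>i t. i \<in> I \<Longrightarrow> t \<in> {0..1} \<Longrightarrow> 0 < fst (b' i t)"
    and apart: "\<And>i j t. i \<in> I \<Longrightarrow> j \<in> I \<Longrightarrow> i \<noteq> j \<Longrightarrow> t \<in> {0..1} \<Longrightarrow>
      same_side (b i t) (b j t) (b' i t) (b' j t)"
  shows "isotopic_links (closed_curves I b) (closed_curves I b')"
proof -
  define v where "v i t = b' i t - b i t" for i t
  define c where "c u i t = b i t + u *\<^sub>R v i t" for u i t
  let ?S = "{0..1} \<times> {0..1} :: (real \<times> real) set"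
  have contv: "continuous_on {0..1} (v i)" if "i \<in> I" for i
    unfolding v_def using cont that by (intro continuous_intros)
  have contc: "continuous_on ?S (\<lambda>x. c (fst x) i (snd x))" if "i \<in> I" for i
    unfolding c_def using that
    by (intro continuous_intros continuous_on_compose2[OF cont(1)] continuous_on_compose2[OF contv]) auto
  have posc: "0 < fst (c (fst x) i (snd x))" if "i \<in> I" "x \<in> ?S" for i x
  proof -
    let ?u = "fst x" and ?t = "snd x"
    have "0 < fst (b i ?t)" "0 < fst (b' i ?t)" "0 \<le> ?u" "?u \<le> 1" using pos that by auto
    then have "0 < (1 - ?u) * fst (b i ?t) + ?u * fst (b' i ?t)"
      by (cases "?u = 0") (auto intro: add_nonneg_pos)
    then show ?thesis by (simp add: c_def v_def algebra_simps)
  qed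
  define A where "A = {a \<in> I \<times> I. fst a \<noteq> snd a}"
  define f where "f a x = norm (c (fst x) (fst a) (snd x) - c (fst x) (snd a) (snd x))" for a x
  have S: "compact ?S" by (intro compact_Times compact_Icc)
  have "finite A" using fin by (simp add: A_def)
  moreover have "continuous_on ?S (f a)" if "a \<in> A" for a
    unfolding f_def using that by (intro continuous_intros contc) (auto simp: A_def)
  moreover have "0 < f a x" if "a \<in> A" "x \<in> ?S" for a x
    using same_side_imp_neq[OF apart[of "fst a" "snd a" "snd x"], of "fst x"] that
    by (auto simp: f_def A_def c_def v_def)
  ultimately have "\<exists>\<delta>1>0. \<forall>a\<in>A. \<forall>x\<in>?S. \<delta>1 \<le> f a x"
    using uniform_lower_bound[OF _ S, of A f] by metis
  then obtain \<delta>1 where \<delta>1: "0 < \<delta>1" "\<And>a x. a \<in> A \<Longrightarrow> x \<in> ?S \<Longrightarrow> \<delta>1 \<le> f a x"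
    by blast
  define h where "h i x = fst (c (fst x) i (snd x))" for i x
  have "continuous_on ?S (h i)" if "i \<in> I" for i
    unfolding h_def by (intro continuous_intros contc that)
  moreover have "0 < h i x" if "i \<in> I" "x \<in> ?S" for i x
    unfolding h_def using posc that by blast
  ultimately have "\<exists>\<delta>2>0. \<forall>i\<in>I. \<forall>x\<in>?S. \<delta>2 \<le> h i x"
    using uniform_lower_bound[OF fin S, of h] by metis
  then obtain \<delta>2 where \<delta>2: "0 < \<delta>2" "\<And>i x. i \<in> I \<Longrightarrow> x \<in> ?S \<Longrightarrow> \<delta>2 \<le> h i x"
    by blast
  define \<delta> where "\<delta> = min \<delta>1 (\<delta>2 / 2)"
  have \<delta>: "0 < \<delta>" "\<delta> \<le> \<delta>1" "2 * \<delta> \<le> \<delta>2" using \<delta>1 \<delta>2 by (auto simp: \<delta>_def)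
  have "\<exists>B>0. \<forall>t\<in>{0..1}. norm (v i t) \<le> B" if "i \<in> I" for i
    using compact_imp_bounded[OF compact_continuous_image[OF contv[OF that] compact_Icc]]
    by (auto simp: bounded_pos)
  then obtain B where B: "\<And>i. i \<in> I \<Longrightarrow> 0 < B i \<and> (\<forall>t\<in>{0..1}. norm (v i t) \<le> B i)" by metis
  define M where "M = (\<Sum>i\<in>I. B i)"
  have M: "norm (v i t) \<le> M" if "i \<in> I" "t \<in> {0..1}" for i t
  proof -
    have "norm (v i t) \<le> B i" using B that by blast
    also have "B i \<le> M" unfolding M_def using that fin B by (intro member_le_sum) (auto intro: less_imp_le)
    finally show ?thesis .
  qed
  have M0: "0 \<le> M" unfolding M_def using B by (intro sum_nonneg) (auto intro: less_imp_le)
  \<comment> \<open>In \<open>n\<close> equal steps, every push is a contraction.\<close>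
  obtain n :: nat where n: "real (card I) * M / \<delta> < real n" using reals_Archimedean2 by blast
  have "0 \<le> real (card I) * M / \<delta>" using M0 \<delta> by simp
  then have n0: "0 < real n" using n by linarith
  have step: "isotopic_links (closed_curves I b) (closed_curves I (c (real m / real n)))" if "m \<le> n" for m
    using that
  proof (induction m)
    case 0
    then show ?case using isotopic_links_refl by (simp add: c_def)
  next
    case (Suc m)
    let ?u = "real m / real n"
    have u: "?u \<in> {0..1}" using Suc.prems n0 by auto
    have "isotopic_links (closed_curves I (c ?u)) (closed_curves I (\<lambda>i t. c ?u i t + (1 / n) *\<^sub>R v i t))"
    proof (rule push_isotopy[where \<delta> = \<delta> and \<epsilon> = "M / n"])
      show "continuous_on {0..1} (c ?u i)" if "i \<in> I" for i
        unfolding c_def using that by (intro continuous_intros cont contv)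
      show "continuous_on {0..1} (\<lambda>t. (1 / n) *\<^sub>R v i t)" if "i \<in> I" for i
        using that by (intro continuous_intros contv)
      show "\<exists>j\<in>I. c ?u j 0 = c ?u i 1 \<and> (1 / n) *\<^sub>R v j 0 = (1 / n) *\<^sub>R v i 1" if "i \<in> I" for i
      proof -
        obtain j where "j \<in> I" "b j 0 = b i 1" "b' j 0 = b' i 1" using match[OF \<open>i \<in> I\<close>] by blast
        then show ?thesis by (intro bexI[of _ j]) (simp_all add: c_def v_def)
      qed
      show "\<delta> \<le> norm (c ?u i t - c ?u j t)" if "i \<in> I" "j \<in> I" "i \<noteq> j" "t \<in> {0..1}" for i j t
        using \<delta>1(2)[of "(i, j)" "(?u, t)"] that u \<delta> by (simp add: A_def f_def)
      show "2 * \<delta> \<le> fst (c ?u i t)" if "i \<in> I" "t \<in> {0..1}" for i t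
        using \<delta>2(2)[of i "(?u, t)"] that u \<delta> by (simp add: h_def)
      show "norm ((1 / n) *\<^sub>R v i t) \<le> M / n" if "i \<in> I" "t \<in> {0..1}" for i t
        using M[OF that] n0 by (simp add: divide_right_mono)
      show "real (card I) * (M / n) < \<delta>" using n n0 \<delta> by (simp add: field_simps)
    qed (use fin \<delta> M0 in auto)
    moreover have "(\<lambda>i t. c ?u i t + (1 / n) *\<^sub>R v i t) = c (real (Suc m) / real n)"
      using n0 by (intro ext) (simp add: c_def add_divide_distrib algebra_simps)
    ultimately show ?case using isotopic_links_trans Suc by (metis Suc_leD)
  qed
  moreover have "c (real n / real n) = b'" using n0 by (intro ext) (simp add: c_def v_def)
  ultimately show ?thesis by (metis order_refl)
qed


section \<open>The half turn about the line of positions\<close>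

lemma half_turn_isotopy:
  "isotopic_links K ((\<lambda>P. vector [P $ 1, - P $ 2, - P $ 3] :: real^3) ` K)"
proof -
  define R where "R s P = (vector [P $ 1, cos (pi * s) * P $ 2 - sin (pi * s) * P $ 3,
    sin (pi * s) * P $ 2 + cos (pi * s) * P $ 3] :: real^3)" for s :: real and P :: "real^3"
  have R_nth: "R s P $ 1 = P $ 1" "R s P $ 2 = cos (pi * s) * P $ 2 - sin (pi * s) * P $ 3"
    "R s P $ 3 = sin (pi * s) * P $ 2 + cos (pi * s) * P $ 3" for s P
    by (simp_all add: R_def)
  have R_axis: "R s P = P $ 1 *\<^sub>R axis 1 1 + (cos (pi * s) * P $ 2 - sin (pi * s) * P $ 3) *\<^sub>R axis 2 1
      + (sin (pi * s) * P $ 2 + cos (pi * s) * P $ 3) *\<^sub>R axis 3 1" for s P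
    by (simp add: vec3_eq_iff R_nth axis_def)
  have cont: "continuous_on UNIV (R s)" for s
    unfolding R_axis[abs_def] by (intro continuous_intros)
  have inv: "R (- s) (R s P) = P" for s P
  proof -
    have "cos (pi * s) * (cos (pi * s) * x) + sin (pi * s) * (sin (pi * s) * x) = x" for x
      using sin_cos_squared_add[of "pi * s"]
      by (metis add.commute distrib_right mult.assoc mult_1 power2_eq_square)
    from this[of "P $ 2"] this[of "P $ 3"] show ?thesis
      unfolding vec3_eq_iff R_nth by (simp add: right_diff_distrib distrib_left)
  qed
  have "isotopic_links K (R 1 ` K)"
  proof (rule isotopic_linksI[where F = R])
    show "continuous_on ({0..1} \<times> UNIV) (\<lambda>(s, P). R s P)"
      unfolding case_prod_beta R_axis by (intro continuous_intros)
    show "\<exists>g. homeomorphism UNIV UNIV (R s) g" for s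
    proof (rule exI[of _ "R (- s)"], rule homeomorphismI)
      show "R s (R (- s) P) = P" for P using inv[of "- s" P] by simp
    qed (use cont inv in auto)
    show "R 0 P = P" for P by (simp add: vec3_eq_iff R_nth)
  qed simp
  moreover have "R 1 P = vector [P $ 1, - P $ 2, - P $ 3]" for P
    by (simp add: R_def)
  ultimately show ?thesis by simp
qed

text \<open>The half turn fixes the half-plane \<open>t = 0\<close> setwise and maps the one at \<open>t\<close> to the one at \<open>1 - t\<close>.\<close>
lemma half_turn_closed_curves:
  "(\<lambda>P. vector [P $ 1, - P $ 2, - P $ 3] :: real^3) ` closed_curves I b =
    closed_curves I (\<lambda>i t. (fst (b i (1 - t)), - snd (b i (1 - t))))"
proof -
  have turn: "vector [cyl t y $ 1, - cyl t y $ 2, - cyl t y $ 3] = cyl (1 - t) (fst y, - snd y)" for t y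
    by (simp add: vec3_eq_iff right_diff_distrib)
  have flip: "(\<lambda>t. f (1 - t)) ` {0..1} = f ` {0..1::real}" for f :: "real \<Rightarrow> real^3"
  proof -
    have "(\<lambda>t. 1 - t) ` {0..1} = {0..1::real}" by simp
    then show ?thesis by (metis image_image)
  qed
  have "(\<lambda>t. cyl (1 - t) (fst (b i t), - snd (b i t))) ` {0..1} =
      (\<lambda>t. cyl t (fst (b i (1 - t)), - snd (b i (1 - t)))) ` {0..1}" for i
    using flip[of "\<lambda>t. cyl t (fst (b i (1 - t)), - snd (b i (1 - t)))"] by simp
  then show ?thesis
    unfolding closed_curves_def image_UN image_image turn by simp
qed


section \<open>Vectors made of square blocks\<close>

text \<open>
  The list \<open>ws\<close> contains the widths of the blocks, and \<open>r\<close> and \<open>s\<close> describe the torus part. A block of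
  width \<open>w\<close> contributes \<open>w\<close> entries \<open>w\<close> to the vector; together these put a full twist into the \<open>w\<close>
  leftmost strands of the torus link.
\<close>
locale full_twists =
  fixes ws :: "nat list" and r s :: nat
  assumes sorted: "sorted ws"
    and narrow: "\<And>w. w \<in> set ws \<Longrightarrow> w \<le> r \<and> w \<le> s"
    and r_pos: "0 < r" and s_pos: "0 < s"
begin

definition offset :: "nat \<Rightarrow> nat" where
  "offset q = sum_list (take q ws)"

text \<open>
  As the widths increase, strand \<open>a\<close> of the ribbon runs through exactly the blocks from \<open>entry a\<close> on;
  if no block is wide enough, it meets only the torus part, which counts as block \<open>Q\<close>. Block \<open>q\<close>
  occupies the positions after \<open>offset q\<close>, and strand \<open>a\<close> has position \<open>offset q + a\<close> in it.
\<close>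
definition entry :: "nat \<Rightarrow> nat" where
  "entry a = (LEAST q. length ws \<le> q \<or> a \<le> ws ! q)"

abbreviation "Q \<equiv> length ws"

lemma entry_spec: "Q \<le> entry a \<or> a \<le> ws ! entry a"
  unfolding entry_def by (rule LeastI[of _ Q]) simp

lemma entry_le: "entry a \<le> Q"
  unfolding entry_def by (rule Least_le) simp

lemma entry_le_iff: "q < Q \<Longrightarrow> entry a \<le> q \<longleftrightarrow> a \<le> ws ! q"
proof
  assume "q < Q" "entry a \<le> q"
  then have "a \<le> ws ! entry a" using entry_spec[of a] by auto
  also have "\<dots> \<le> ws ! q" using sorted \<open>entry a \<le> q\<close> \<open>q < Q\<close> by (rule sorted_nth_mono)
  finally show "a \<le> ws ! q" .
next
  assume "a \<le> ws ! q"
  then show "entry a \<le> q" unfolding entry_def by (intro Least_le) simp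
qed

lemma entry_mono: "a \<le> b \<Longrightarrow> entry a \<le> entry b"
  using entry_spec[of b] entry_le[of a] entry_le_iff[of "entry b" a] by (meson le_trans not_le)

lemma row_narrow: "entry a \<le> q \<Longrightarrow> q < Q \<Longrightarrow> a \<le> r \<and> a \<le> s"
  using entry_le_iff narrow nth_mem le_trans by blast

lemma entry_wide: "r < a \<or> s < a \<Longrightarrow> entry a = Q"
  using row_narrow[of a "entry a"] entry_le[of a] by linarith

lemma offset_Suc: "q < Q \<Longrightarrow> offset (Suc q) = offset q + ws ! q"
  by (simp add: offset_def take_Suc_conv_app_nth)

lemma offset_mono: "p \<le> q \<Longrightarrow> offset p \<le> offset q"
  unfolding offset_def by (metis le_add1 le_add_diff_inverse sum_list_append take_add)

lemma offset_add_le: "entry a \<le> p \<Longrightarrow> p < q \<Longrightarrow> q \<le> Q \<Longrightarrow> offset p + a \<le> offset q"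
  using offset_Suc[of p] entry_le_iff[of p a] offset_mono[of "Suc p" q] by linarith

text \<open>
  Positions are ordered lexicographically by block and strand, since \<open>entry a \<le> p\<close> keeps strand \<open>a\<close>
  within the width of block \<open>p\<close>.
\<close>
lemma position_less:
  assumes "entry a \<le> p" "q \<le> Q" "p < q \<or> p = q \<and> a < b" "1 \<le> b"
  shows "offset p + a < offset q + b"
  using assms offset_add_le[of a p q] by auto

lemma position_inj:
  assumes "entry a \<le> p" "p \<le> Q" "entry b \<le> q" "q \<le> Q" "1 \<le> a" "1 \<le> b"
    and "offset p + a = offset q + b"
  shows "p = q \<and> a = b"
  using assms position_less[of a p q b] position_less[of b q p a] by (metis less_irrefl linorder_neqE_nat)

lemma position_exists:
  assumes "1 \<le> y" "y \<le> offset p" "p \<le> Q"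
  obtains a q where "y = offset q + a" "1 \<le> a" "entry a \<le> q" "q < p"
  using assms
proof (induction p arbitrary: thesis)
  case 0
  then show ?case by (simp add: offset_def)
next
  case (Suc p)
  show ?case
  proof (cases "y \<le> offset p")
    case True
    then show ?thesis using Suc by (metis Suc_leD less_Suc_eq)
  next
    case False
    then have "y = offset p + (y - offset p)" "1 \<le> y - offset p" by auto
    moreover have "entry (y - offset p) \<le> p"
      using Suc.prems offset_Suc[of p] entry_le_iff[of p] by auto
    ultimately show ?thesis using Suc.prems(1) by blast
  qed
qed

definition twist_vector :: "nat list" where
  "twist_vector = concat (map (\<lambda>w. replicate w w) ws)"

lemma length_twist_vector: "length twist_vector = offset Q"
  by (simp add: twist_vector_def offset_def length_concat comp_def)

lemma twist_vector_nth:
  assumes "q < Q" "i < ws ! q"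
  shows "twist_vector ! (offset q + i) = ws ! q"
proof -
  let ?f = "\<lambda>vs. concat (map (\<lambda>w::nat. replicate w w) vs)"
  have "ws = take q ws @ ws ! q # drop (Suc q) ws" using assms by (simp add: id_take_nth_drop)
  then have "twist_vector = ?f (take q ws @ ws ! q # drop (Suc q) ws)"
    unfolding twist_vector_def by metis
  then have "twist_vector = ?f (take q ws) @ replicate (ws ! q) (ws ! q) @ ?f (drop (Suc q) ws)"
    by simp
  moreover have "length (?f (take q ws)) = offset q"
    by (simp add: offset_def length_concat comp_def)
  ultimately show ?thesis using assms(2) by (simp add: nth_append)
qed


section \<open>End positions of the Lorenz braid\<close>

text \<open>
  Both links of the theorem have a vector of this form: \<open>shift\<close> and \<open>overs\<close> are \<open>r\<close> and \<open>s\<close> for the one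
  and \<open>s\<close> and \<open>r\<close> for the other.
\<close>
context
  fixes d :: "nat list" and shift overs :: nat
  assumes d: "d = twist_vector @ replicate overs shift" and overs: "0 < overs"
    and shift: "\<And>w. w \<in> set ws \<Longrightarrow> w \<le> shift"
begin

lemma length_d: "length d = offset Q + overs"
  by (simp add: d length_twist_vector)

lemma width_d: "lorenz_width d = offset Q + overs + shift"
  using overs by (simp add: lorenz_width_def length_d) (simp add: d)

lemma lorenz_end_row:
  assumes "1 \<le> a" "entry a \<le> q" "q < Q"
  shows "lorenz_end d (offset q + a) = offset (Suc q) + a"
proof -
  have a: "a \<le> ws ! q" using assms entry_le_iff by blast
  have le: "offset q + a \<le> offset Q" using assms by (intro offset_add_le) auto
  have "offset q + a - 1 = offset q + (a - 1)" "offset q + (a - 1) < length twist_vector"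
    using le assms by (auto simp: length_twist_vector)
  then have "d ! (offset q + a - 1) = twist_vector ! (offset q + (a - 1))"
    by (simp only: d nth_append if_True)
  also have "\<dots> = ws ! q" using a assms by (intro twist_vector_nth) auto
  finally show ?thesis
    using le assms by (simp add: lorenz_end_def length_d offset_Suc)
qed

lemma lorenz_end_over:
  assumes "1 \<le> b" "b \<le> overs"
  shows "lorenz_end d (offset Q + b) = offset Q + shift + b"
proof -
  have "offset Q + b - 1 = length twist_vector + (b - 1)"
    using assms by (simp add: length_twist_vector)
  then have "d ! (offset Q + b - 1) = shift"
    using assms by (simp only: d nth_append_length_plus) (simp add: Suc_le_eq)
  then show ?thesis using assms by (simp add: lorenz_end_def length_d)
qed

lemma over_endsE:
  assumes "y \<in> over_ends d"
  obtains a q where "1 \<le> a" "entry a \<le> q" "q < Q" "y = offset (Suc q) + a"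
  | b where "1 \<le> b" "b \<le> overs" "y = offset Q + shift + b"
proof -
  obtain i where i: "1 \<le> i" "i \<le> length d" "y = lorenz_end d i"
    using assms by (auto simp: over_ends_def lorenz_end_def)
  show thesis
  proof (cases "i \<le> offset Q")
    case True
    then obtain a q where "i = offset q + a" "1 \<le> a" "entry a \<le> q" "q < Q"
      using i(1) by (rule_tac position_exists[of i Q]) auto
    then show thesis using that(1) lorenz_end_row i by blast
  next
    case False
    then have "i = offset Q + (i - offset Q)" "1 \<le> i - offset Q" "i - offset Q \<le> overs"
      using i length_d by auto
    then show thesis using that(2) lorenz_end_over i by metis
  qed
qed

lemma lorenz_end_in_over_ends: "1 \<le> i \<Longrightarrow> i \<le> length d \<Longrightarrow> lorenz_end d i \<in> over_ends d"
  by (auto simp: over_ends_def lorenz_end_def)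

text \<open>
  For \<open>a \<le> shift\<close>, an overcrossing strand ends at strand \<open>a\<close> of block \<open>p\<close> exactly if \<open>a\<close> already occurs in the block
  before \<open>p\<close>. What remains for the undercrossing strands are the first positions of the strands,
  those with \<open>p = entry a\<close>.
\<close>
lemma under_ends:
  "{1..lorenz_width d} - over_ends d = (\<lambda>c. offset (entry c) + c) ` {1..shift}"
proof (intro equalityI subsetI)
  fix y assume y: "y \<in> {1..lorenz_width d} - over_ends d"
  have row: "y \<noteq> offset (Suc q) + a" if "1 \<le> a" "entry a \<le> q" "q < Q" for a q
    using y lorenz_end_row[OF that] lorenz_end_in_over_ends[of "offset q + a"] that
      offset_add_le[OF that(2,3)] length_d by auto
  have entry_eq: "entry a = p" if "1 \<le> a" "entry a \<le> p" "p \<le> Q" "y = offset p + a" for a p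
  proof (rule ccontr)
    assume "entry a \<noteq> p"
    then have "entry a \<le> p - 1" "p - 1 < Q" "Suc (p - 1) = p" using that by auto
    then show False using row[of a "p - 1"] that by simp
  qed
  consider "y \<le> offset Q" | "offset Q < y" "y \<le> offset Q + shift" | "offset Q + shift < y"
    by linarith
  then show "y \<in> (\<lambda>c. offset (entry c) + c) ` {1..shift}"
  proof cases
    case 1
    then obtain a q where aq: "y = offset q + a" "1 \<le> a" "entry a \<le> q" "q < Q"
      using y by (rule_tac position_exists[of y Q]) auto
    then have "a \<le> shift" using entry_le_iff shift nth_mem le_trans by blast
    then show ?thesis using entry_eq[of a q] aq by force
  next
    case 2
    then have "y = offset Q + (y - offset Q)" "1 \<le> y - offset Q" by auto
    then show ?thesis using entry_eq[of "y - offset Q" Q] entry_le 2 by force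
  next
    case 3
    then have b: "y = offset Q + shift + (y - offset Q - shift)" "1 \<le> y - offset Q - shift"
      "y - offset Q - shift \<le> overs"
      using y width_d by auto
    then have "y \<in> over_ends d"
      using lorenz_end_over[OF b(2,3)] lorenz_end_in_over_ends[of "offset Q + (y - offset Q - shift)"]
        length_d by auto
    then show ?thesis using y by blast
  qed
next
  fix y assume "y \<in> (\<lambda>c. offset (entry c) + c) ` {1..shift}"
  then obtain c where c: "1 \<le> c" "c \<le> shift" "y = offset (entry c) + c" by auto
  have le: "y \<le> offset Q + shift" using c offset_mono[OF entry_le[of c]] by simp
  have "y \<notin> over_ends d"
  proof
    assume "y \<in> over_ends d"
    then show False
    proof (cases rule: over_endsE)
      case (1 a q)
      then have "entry c = Suc q \<and> c = a"
        using c entry_le[of c] by (intro position_inj) auto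
      then have "entry a = Suc q" by blast
      then show False using 1(2) by simp
    next
      case (2 b)
      then show False using le by simp
    qed
  qed
  then show "y \<in> {1..lorenz_width d} - over_ends d" using c le width_d by simp
qed

text \<open>
  The undercrossing strands fill the remaining positions in order, and \<open>offset (entry c) + c\<close>
  increases with \<open>c\<close>.
\<close>
lemma lorenz_end_under:
  assumes "1 \<le> c" "c \<le> shift"
  shows "lorenz_end d (offset Q + overs + c) = offset (entry c) + c"
proof -
  let ?f = "\<lambda>c. offset (entry c) + c"
  let ?l = "map ?f [1..<Suc shift]"
  have less: "?f a < ?f b" if "a < b" for a b
    using that offset_mono[OF entry_mono[of a b]] by simp
  have "sorted_wrt (<) ?l"
    unfolding sorted_wrt_map by (rule sorted_wrt_mono_rel[OF _ sorted_wrt_upt]) (use less in auto)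
  then have "sorted ?l" "distinct ?l"
    using strict_sorted_iff by blast+
  then have "sorted_list_of_set (set ?l) = ?l"
    by (rule sorted_list_of_set.idem_if_sorted_distinct)
  moreover have "set ?l = {1..lorenz_width d} - over_ends d"
    unfolding under_ends by (auto simp: atLeastLessThanSuc_atLeastAtMost simp del: upt_Suc)
  ultimately have "sorted_list_of_set ({1..lorenz_width d} - over_ends d) = ?l" by simp
  moreover have "[1..<Suc shift] ! (c - 1) = c"
    using assms by (subst nth_upt) auto
  ultimately show ?thesis
    using assms by (simp add: lorenz_end_def length_d del: upt_Suc)
qed

end

end


section \<open>The strands of the two spirals\<close>

text \<open>
  The strands of both closed braids, labelled so that the homotopies respect the labels.
  \<open>In c\<close> arrives from the right part of the braid, \<open>Out a\<close> leaves for it, and \<open>Row a q\<close> with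
  \<open>entry a \<le> q < Q\<close> is a further turn of strand \<open>a\<close> of the ribbon. Along the link,
  strand \<open>a\<close> of the ribbon consists of \<open>In a\<close>, the rows \<open>Row a q\<close> in the order of \<open>q\<close>, and \<open>Out a\<close>.
\<close>
datatype strand = Row nat nat | Out nat | In nat

text \<open>The first coordinate of a strand of a Lorenz braid from position \<open>x\<close> to position \<open>y\<close>.\<close>
definition seg :: "nat \<Rightarrow> nat \<Rightarrow> real \<Rightarrow> real" where
  "seg x y t = (1 - t) * real x + t * real y"

lemma seg_ends [simp]: "seg x y 0 = real x" "seg x y 1 = real y"
  by (simp_all add: seg_def)

lemma seg_less:
  assumes "x < x'" "y < y'" "t \<in> {0..1}"
  shows "seg x y t < seg x' y' t"
  unfolding seg_def using assms
  by (cases "t = 0") (auto intro!: add_le_less_mono mult_left_mono mult_strict_left_mono)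

lemma seg_mono: "x \<le> x' \<Longrightarrow> y \<le> y' \<Longrightarrow> t \<in> {0..1} \<Longrightarrow> seg x y t \<le> seg x' y' t"
  unfolding seg_def by (intro add_mono mult_left_mono) auto

lemma seg_const: "seg x x t = real x"
  by (simp add: seg_def algebra_simps)

lemma seg_lower: "x \<le> p \<Longrightarrow> x \<le> q \<Longrightarrow> t \<in> {0..1} \<Longrightarrow> real x \<le> seg p q t"
  using seg_mono[of x p x q t] by (simp add: seg_const)

lemma seg_upper: "p \<le> x \<Longrightarrow> q \<le> x \<Longrightarrow> t \<in> {0..1} \<Longrightarrow> seg p q t \<le> real x"
  using seg_mono[of p x q x t] by (simp add: seg_const)

lemma same_side_commute: "same_side p q p' q' \<longleftrightarrow> same_side q p q' p'"
  unfolding same_side_def by (simp add: algebra_simps)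

lemma same_side_x: "x < y \<Longrightarrow> x' < y' \<Longrightarrow> same_side (x, z) (y, w) (x', z') (y', w')"
  by (simp add: same_side_def mult_neg_neg)

lemma same_side_x': "x \<noteq> y \<Longrightarrow> same_side (x, z) (y, w) (x, z') (y, w')"
  by (simp add: same_side_def flip: power2_eq_square)

lemma same_side_z: "z < w \<Longrightarrow> z' < w' \<Longrightarrow> same_side (x, z) (y, w) (x', z') (y', w')"
  by (simp add: same_side_def mult_neg_neg)

lemma same_side_z': "w < z \<Longrightarrow> w' < z' \<Longrightarrow> same_side (x, z) (y, w) (x', z') (y', w')"
  by (simp add: same_side_def)

context full_twists
begin

definition strands :: "strand set" where
  "strands = {Row a q | a q. 1 \<le> a \<and> entry a \<le> q \<and> q < Q} \<union> Out ` {1..r} \<union> In ` {1..s}"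

lemma strands_iff [simp]:
  "Row a q \<in> strands \<longleftrightarrow> 1 \<le> a \<and> entry a \<le> q \<and> q < Q"
  "Out a \<in> strands \<longleftrightarrow> 1 \<le> a \<and> a \<le> r"
  "In c \<in> strands \<longleftrightarrow> 1 \<le> c \<and> c \<le> s"
  by (auto simp: strands_def)

lemma finite_strands: "finite strands"
proof (rule finite_subset)
  show "strands \<subseteq> (\<lambda>(a, q). Row a q) ` ({..r} \<times> {..<Q}) \<union> Out ` {1..r} \<union> In ` {1..s}"
    using row_narrow by (auto simp: strands_def)
qed auto

text \<open>
  In the outward spiral, \<open>Row a q\<close> leads from block \<open>q\<close> to the next one. In the inward spiral, strand
  \<open>a\<close> visits the same blocks in the opposite order; \<open>q\<close> still counts the turns in the order in which
  they are run through, so that block \<open>q\<close> is replaced by block \<open>Q + entry a - q\<close>.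
\<close>
fun start_out end_out :: "strand \<Rightarrow> nat" where
  "start_out (Row a q) = offset q + a"
| "start_out (Out a) = offset Q + a"
| "start_out (In c) = offset Q + r + c"
| "end_out (Row a q) = offset (Suc q) + a"
| "end_out (Out a) = offset Q + s + a"
| "end_out (In c) = offset (entry c) + c"

fun start_in end_in :: "strand \<Rightarrow> nat" where
  "start_in (Row a q) = offset (Q + entry a - q) + a"
| "start_in (Out a) = offset (entry a) + a"
| "start_in (In c) = offset Q + r + c"
| "end_in (Row a q) = offset (Q + entry a - Suc q) + a"
| "end_in (Out a) = offset Q + s + a"
| "end_in (In c) = offset Q + c"

abbreviation "x_in i \<equiv> seg (start_in i) (end_in i)"
abbreviation "x_out i \<equiv> seg (start_out i) (end_out i)"

text \<open>Rows never go beyond position \<open>M - 1\<close>, and arriving strands start at \<open>M\<close> or further to the right.\<close>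
abbreviation "M \<equiv> real (offset Q + r + 1)"

text \<open>
  Heights that increase along the ribbon from \<open>entry a - Q\<close> to \<open>0\<close>. An arriving strand must reach its
  low final height before it meets the ribbon; before time \<open>1 / M\<close> it is still to the right of
  position \<open>M - 1\<close>, which leaves enough time for the descent. Departing strands, and arriving ones
  that do not join the ribbon, have height \<open>0\<close> at both ends.
\<close>
fun climb :: "strand \<Rightarrow> real \<Rightarrow> real" where
  "climb (Row a q) t = real q + t - real Q"
| "climb (Out a) t = t * (1 - t)"
| "climb (In c) t = - (min 1 (M * t) * (real Q - real (entry c)))"

text \<open>The heights after the half turn: the overcrossing strands have come to lie below the others.\<close>
fun under :: "strand \<Rightarrow> real \<Rightarrow> real" where
  "under (Row a q) t = - (t * (1 - t))"
| "under (Out a) t = 0"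
| "under (In c) t = - (t * (1 - t))"

text \<open>The heights of a Lorenz braid.\<close>
fun over :: "strand \<Rightarrow> real \<Rightarrow> real" where
  "over (Row a q) t = t * (1 - t)"
| "over (Out a) t = t * (1 - t)"
| "over (In c) t = 0"

lemma heights_at_ends [simp]: "under i 0 = 0" "under i 1 = 0" "over i 0 = 0" "over i 1 = 0"
  by (cases i; simp)+

lemma continuous_heights:
  "continuous_on {0..1} (climb i)" "continuous_on {0..1} (under i)" "continuous_on {0..1} (over i)"
  by (cases i; auto intro!: continuous_intros)+

text \<open>
  One rule of succession serves the inward spiral, the outward spiral and the increasing heights;
  hence a homotopy between them that respects the labels keeps the strands glued together.
\<close>
lemma successor:
  assumes "i \<in> strands"
  shows "\<exists>j\<in>strands. start_in j = end_in i \<and> start_out j = end_out i \<and> climb j 0 = climb i 1"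
proof (cases i)
  case (Row a q)
  show ?thesis
  proof (cases "Suc q < Q")
    case True
    then show ?thesis using Row assms by (intro bexI[of _ "Row a (Suc q)"]) auto
  next
    case False
    then have "Suc q = Q" using Row assms by simp
    then show ?thesis using Row assms row_narrow[of a q] by (intro bexI[of _ "Out a"]) auto
  qed
next
  case (Out a)
  show ?thesis
  proof (cases "s + a \<le> r")
    case True
    then show ?thesis using Out assms entry_wide[of "s + a"] by (intro bexI[of _ "Out (s + a)"]) auto
  next
    case False
    then show ?thesis using Out assms by (intro bexI[of _ "In (s + a - r)"]) auto
  qed
next
  case (In c)
  show ?thesis
  proof (cases "entry c < Q")
    case True
    then show ?thesis using In assms by (intro bexI[of _ "Row c (entry c)"]) auto
  next
    case False
    then have Q: "entry c = Q" using entry_le[of c] by simp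
    show ?thesis
    proof (cases "c \<le> r")
      case True
      then show ?thesis using In assms Q by (intro bexI[of _ "Out c"]) auto
    next
      case False
      then show ?thesis using In assms Q by (intro bexI[of _ "In (c - r)"]) auto
    qed
  qed
qed

lemma ends_positive: "i \<in> strands \<Longrightarrow> 1 \<le> start_in i \<and> 1 \<le> end_in i \<and> 1 \<le> start_out i \<and> 1 \<le> end_out i"
  by (cases i) auto

lemma x_positive:
  assumes "i \<in> strands" "t \<in> {0..1}"
  shows "0 < x_in i t" "0 < x_out i t"
  using seg_lower[of 1 "start_in i" "end_in i" t] seg_lower[of 1 "start_out i" "end_out i" t]
    ends_positive[of i] assms by auto

text \<open>What remains for each of the three homotopies is the comparison of any two strands.\<close>
lemma isotopic_segments:
  assumes cont: "\<And>i. continuous_on {0..1} (h i)" "\<And>i. continuous_on {0..1} (h' i)"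
    and x: "x = x_in \<and> x' = x_in \<or> x = x_in \<and> x' = x_out \<or> x = x_out \<and> x' = x_out"
    and heights: "\<And>i j. start_in j = end_in i \<Longrightarrow> climb j 0 = climb i 1 \<Longrightarrow> h j 0 = h i 1 \<and> h' j 0 = h' i 1"
    and apart: "\<And>i j t. i \<in> strands \<Longrightarrow> j \<in> strands \<Longrightarrow> i \<noteq> j \<Longrightarrow> t \<in> {0..1} \<Longrightarrow>
      same_side (x i t, h i t) (x j t, h j t) (x' i t, h' i t) (x' j t, h' j t)"
  shows "isotopic_links (closed_curves strands (\<lambda>i t. (x i t, h i t)))
    (closed_curves strands (\<lambda>i t. (x' i t, h' i t)))"
proof (rule linear_isotopy)
  have "continuous_on {0..1} (seg p q)" for p q unfolding seg_def by (intro continuous_intros)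
  then show "continuous_on {0..1} (\<lambda>t. (x i t, h i t))" "continuous_on {0..1} (\<lambda>t. (x' i t, h' i t))" for i
    using x cont by (auto intro!: continuous_intros)
  show "\<exists>j\<in>strands. (x j 0, h j 0) = (x i 1, h i 1) \<and> (x' j 0, h' j 0) = (x' i 1, h' i 1)"
    if "i \<in> strands" for i
  proof -
    obtain j where "j \<in> strands" "start_in j = end_in i" "start_out j = end_out i" "climb j 0 = climb i 1"
      using successor[OF \<open>i \<in> strands\<close>] by blast
    then show ?thesis using x heights by (intro bexI[of _ j]) auto
  qed
  show "0 < fst (x i t, h i t)" "0 < fst (x' i t, h' i t)" if "i \<in> strands" "t \<in> {0..1}" for i t
    using x x_positive[OF that] by auto
qed (use finite_strands apart in auto)


section \<open>Comparison of two strands\<close>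

lemma strand_pairs:
  assumes "i \<in> strands" "j \<in> strands" "i \<noteq> j"
    and sym: "\<And>i j. P i j \<Longrightarrow> P j i"
    and rows: "\<And>a q a' q'. Row a q \<in> strands \<Longrightarrow> Row a' q' \<in> strands \<Longrightarrow> q < q' \<or> q = q' \<and> a < a' \<Longrightarrow> P (Row a q) (Row a' q')"
    and row_out: "\<And>a q a'. Row a q \<in> strands \<Longrightarrow> Out a' \<in> strands \<Longrightarrow> P (Row a q) (Out a')"
    and row_in: "\<And>a q c. Row a q \<in> strands \<Longrightarrow> In c \<in> strands \<Longrightarrow> P (Row a q) (In c)"
    and outs: "\<And>a a'. Out a \<in> strands \<Longrightarrow> Out a' \<in> strands \<Longrightarrow> a < a' \<Longrightarrow> P (Out a) (Out a')"
    and out_in: "\<And>a c. Out a \<in> strands \<Longrightarrow> In c \<in> strands \<Longrightarrow> P (Out a) (In c)"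
    and ins: "\<And>c c'. In c \<in> strands \<Longrightarrow> In c' \<in> strands \<Longrightarrow> c < c' \<Longrightarrow> P (In c) (In c')"
  shows "P i j"
proof (cases i; cases j)
  fix a q a' q' assume *: "i = Row a q" "j = Row a' q'"
  then have "(q < q' \<or> q = q' \<and> a < a') \<or> (q' < q \<or> q' = q \<and> a' < a)" using assms(3) by auto
  then show ?thesis using * rows sym assms by blast
next
  fix a a' assume *: "i = Out a" "j = Out a'"
  then have "a < a' \<or> a' < a" using assms(3) by auto
  then show ?thesis using * outs sym assms by blast
next
  fix a a' assume *: "i = In a" "j = In a'"
  then have "a < a' \<or> a' < a" using assms(3) by auto
  then show ?thesis using * ins sym assms by blast
qed (use assms in blast)+

text \<open>
  For \<open>Row a q\<close> in the inward spiral, the block is \<open>Q + entry a - q\<close>; the comparison of blocks is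
  written without subtraction.
\<close>
lemma rows_in_less:
  assumes "Row a q \<in> strands" "Row a' q' \<in> strands" "t \<in> {0..1}"
    and "q' + entry a < q + entry a' \<or> q' + entry a = q + entry a' \<and> a < a'"
  shows "x_in (Row a q) t < x_in (Row a' q') t"
proof (rule seg_less)
  show "start_in (Row a q) < start_in (Row a' q')"
    unfolding start_in.simps by (rule position_less) (use assms in auto)
  show "end_in (Row a q) < end_in (Row a' q')"
    unfolding end_in.simps by (rule position_less) (use assms in auto)
qed (use assms in simp)

lemma rows_out_less:
  assumes "Row a q \<in> strands" "Row a' q' \<in> strands" "t \<in> {0..1}" "q < q' \<or> q = q' \<and> a < a'"
  shows "x_out (Row a q) t < x_out (Row a' q') t"
proof (rule seg_less)
  show "start_out (Row a q) < start_out (Row a' q')"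
    unfolding start_out.simps by (rule position_less) (use assms in auto)
  show "end_out (Row a q) < end_out (Row a' q')"
    unfolding end_out.simps by (rule position_less) (use assms in auto)
qed (use assms in simp)

lemma row_out_in:
  assumes "Row a q \<in> strands" "Out b \<in> strands"
  shows "start_in (Row a q) \<noteq> start_in (Out b)" "end_in (Row a q) < end_in (Out b)"
proof -
  show "start_in (Row a q) \<noteq> start_in (Out b)"
  proof
    assume "start_in (Row a q) = start_in (Out b)"
    then have "Q + entry a - q = entry b \<and> a = b"
      using assms entry_le[of b] by (intro position_inj) auto
    then show False using assms by auto
  qed
  have "a \<le> s" using row_narrow[of a q] assms by simp
  moreover have "offset (Q + entry a - Suc q) \<le> offset Q" using assms by (intro offset_mono) auto
  ultimately show "end_in (Row a q) < end_in (Out b)" using assms by simp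
qed

lemma row_out_out:
  assumes "Row a q \<in> strands" "Out b \<in> strands"
  shows "start_out (Row a q) < start_out (Out b)" "end_out (Row a q) < end_out (Out b)"
proof -
  have "a \<le> s" using row_narrow[of a q] assms by simp
  moreover have "offset (Suc q) \<le> offset Q" using assms by (intro offset_mono) auto
  moreover have "offset q + a \<le> offset Q" using assms by (intro offset_add_le) auto
  ultimately show "start_out (Row a q) < start_out (Out b)" "end_out (Row a q) < end_out (Out b)"
    using assms by auto
qed

lemma row_in_in:
  assumes "Row a q \<in> strands" "In c \<in> strands" "t \<in> {0..1}"
  shows "x_in (Row a q) t < x_in (In c) t"
proof (rule seg_less)
  have "a \<le> r" using row_narrow[of a q] assms by simp
  moreover have "offset (Q + entry a - q) \<le> offset Q" using assms by (intro offset_mono) auto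
  ultimately show "start_in (Row a q) < start_in (In c)" using assms by simp
  have "offset (Q + entry a - Suc q) + a \<le> offset Q" using assms by (intro offset_add_le) auto
  then show "end_in (Row a q) < end_in (In c)" using assms by simp
qed (use assms in simp)

text \<open>
  For \<open>q < entry c\<close> the row ends before the block that \<open>c\<close> enters. The other rows are crossed by
  \<open>In c\<close>, but not before time \<open>1 / M\<close>.
\<close>
lemma row_in_out:
  assumes "Row a q \<in> strands" "In c \<in> strands" "t \<in> {0..1}"
    and "q < entry c \<or> M * t < 1"
  shows "x_out (Row a q) t < x_out (In c) t"
proof -
  have a: "a \<le> r" using row_narrow[of a q] assms by simp
  have starts: "offset q + a \<le> offset Q" using assms by (intro offset_add_le) auto
  have ends: "offset (Suc q) \<le> offset Q" using assms by (intro offset_mono) auto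
  show ?thesis
  proof (cases "q < entry c")
    case True
    then have "\<not> entry c \<le> entry a" using assms by simp
    then have "a < c" using entry_mono[of c a] by linarith
    moreover have "offset (Suc q) \<le> offset (entry c)" using True by (intro offset_mono) simp
    ultimately show ?thesis using starts assms by (intro seg_less) auto
  next
    case False
    then have "M * t < 1" using assms by simp
    have "x_out (Row a q) t \<le> real (offset Q + r)"
      using starts ends a assms by (intro seg_upper) auto
    also have "\<dots> < M - M * t" using \<open>M * t < 1\<close> by simp
    also have "\<dots> = (1 - t) * M" by (simp add: algebra_simps)
    also have "\<dots> \<le> (1 - t) * real (start_out (In c))"
      using assms by (intro mult_left_mono) auto
    also have "\<dots> \<le> (1 - t) * real (start_out (In c)) + t * real (end_out (In c))"
      using assms by simp
    finally show ?thesis by (simp add: seg_def)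
  qed
qed

lemma row_climbs_above_in:
  assumes "Row a q \<in> strands" "t \<in> {0..1}" "entry c \<le> q" "1 \<le> M * t"
  shows "climb (In c) t < climb (Row a q) t"
proof -
  have "t \<noteq> 0" using assms by auto
  then show ?thesis using assms by (simp add: min_def)
qed

lemma climb_signs:
  assumes "0 < t" "t < 1"
  shows "q < Q \<Longrightarrow> climb (Row a q) t < 0" "0 < climb (Out b) t" "climb (In c) t \<le> 0"
  using assms entry_le[of c] by auto

lemma outs_less:
  assumes "Out a \<in> strands" "Out b \<in> strands" "a < b" "t \<in> {0..1}"
  shows "x_in (Out a) t < x_in (Out b) t" "x_out (Out a) t < x_out (Out b) t"
  using assms offset_mono[OF entry_mono[of a b]] by (auto intro!: seg_less)

lemma ins_less:
  assumes "In a \<in> strands" "In b \<in> strands" "a < b" "t \<in> {0..1}"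
  shows "x_in (In a) t < x_in (In b) t" "x_out (In a) t < x_out (In b) t"
  using assms offset_mono[OF entry_mono[of a b]] by (auto intro!: seg_less)

lemma out_in_ends:
  assumes "Out a \<in> strands" "In c \<in> strands"
  shows "start_in (Out a) < start_in (In c)" "end_in (In c) < end_in (Out a)"
    "start_out (Out a) < start_out (In c)" "end_out (In c) < end_out (Out a)"
  using assms offset_mono[OF entry_le[of a]] offset_mono[OF entry_le[of c]] by auto


section \<open>From the inward to the outward spiral\<close>

text \<open>
  The distances from the axis do not change, so only pairs that cross need attention. In the
  inward spiral, rows and arriving strands run in parallel and cross only the departing strands,
  which are above them for both choices of heights.
\<close>
lemma raise_inward_strands:
  "isotopic_links (closed_curves strands (\<lambda>i t. (x_in i t, under i t)))
    (closed_curves strands (\<lambda>i t. (x_in i t, climb i t)))"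
proof (rule isotopic_segments)
  fix i j :: strand and t :: real
  assume ij: "i \<in> strands" "j \<in> strands" "i \<noteq> j" and t: "t \<in> {0..1}"
  show "same_side (x_in i t, under i t) (x_in j t, under j t) (x_in i t, climb i t) (x_in j t, climb j t)"
    using ij
  proof (rule strand_pairs)
    fix a q a' q' assume rows: "Row a q \<in> strands" "Row a' q' \<in> strands" "q < q' \<or> q = q' \<and> a < a'"
    then have "x_in (Row a q) t \<noteq> x_in (Row a' q') t"
      using rows_in_less[of a q a' q' t] rows_in_less[of a' q' a q t] t
      by (cases "q' + entry a < q + entry a'"; cases "q' + entry a = q + entry a'"; cases a a' rule: linorder_cases)
        auto
    then show "same_side (x_in (Row a q) t, under (Row a q) t) (x_in (Row a' q') t, under (Row a' q') t)
        (x_in (Row a q) t, climb (Row a q) t) (x_in (Row a' q') t, climb (Row a' q') t)"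
      by (rule same_side_x')
  next
    fix a q b assume "Row a q \<in> strands" "Out b \<in> strands"
    note facts = this
    show "same_side (x_in (Row a q) t, under (Row a q) t) (x_in (Out b) t, under (Out b) t)
        (x_in (Row a q) t, climb (Row a q) t) (x_in (Out b) t, climb (Out b) t)"
    proof (cases "t = 0 \<or> t = 1")
      \<comment> \<open>At the ends the heights may agree, but the positions differ.\<close>
      case True
      then show ?thesis
        using facts row_out_in[of a q b] climb_signs(1)[of t q a] climb_signs(2)[of t b]
        by (auto intro!: same_side_x' simp del: start_in.simps end_in.simps start_out.simps end_out.simps)
    next
      case False
      then have "0 < t" "t < 1" using t by auto
      then show ?thesis
        using facts row_out_in[of a q b] climb_signs(1)[of t q a] climb_signs(2)[of t b]
        by (intro same_side_z) (auto simp del: climb.simps)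
    qed
  next
    fix a q c assume "Row a q \<in> strands" "In c \<in> strands"
    then show "same_side (x_in (Row a q) t, under (Row a q) t) (x_in (In c) t, under (In c) t)
        (x_in (Row a q) t, climb (Row a q) t) (x_in (In c) t, climb (In c) t)"
      using row_in_in[of a q c t] t by (intro same_side_x) auto
  next
    fix a b assume "Out a \<in> strands" "Out b \<in> strands" "a < b"
    then show "same_side (x_in (Out a) t, under (Out a) t) (x_in (Out b) t, under (Out b) t)
        (x_in (Out a) t, climb (Out a) t) (x_in (Out b) t, climb (Out b) t)"
      using outs_less[of a b t] t by (intro same_side_x) auto
  next
    fix a c assume "Out a \<in> strands" "In c \<in> strands"
    note facts = this
    show "same_side (x_in (Out a) t, under (Out a) t) (x_in (In c) t, under (In c) t)
        (x_in (Out a) t, climb (Out a) t) (x_in (In c) t, climb (In c) t)"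
    proof (cases "t = 0 \<or> t = 1")
      \<comment> \<open>At the ends the heights may agree, but the positions differ.\<close>
      case True
      then show ?thesis
        using facts out_in_ends[of a c] climb_signs(2)[of t a] climb_signs(3)[of t c]
        by (auto intro!: same_side_x' simp del: start_in.simps end_in.simps start_out.simps end_out.simps)
    next
      case False
      then have "0 < t" "t < 1" using t by auto
      then show ?thesis
        using facts out_in_ends[of a c] climb_signs(2)[of t a] climb_signs(3)[of t c]
        by (intro same_side_z') (auto simp del: climb.simps)
    qed
  next
    fix a b assume "In a \<in> strands" "In b \<in> strands" "a < b"
    then show "same_side (x_in (In a) t, under (In a) t) (x_in (In b) t, under (In b) t)
        (x_in (In a) t, climb (In a) t) (x_in (In b) t, climb (In b) t)"
      using ins_less[of a b t] t by (intro same_side_x) auto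
  qed (use same_side_commute in blast)
qed (use continuous_heights in auto)

text \<open>
  Different turns of the ribbon have different heights, and for equal turns the order of the
  parallel strands is the same in both spirals. At any time, an arriving strand is to the right of
  a given row in both spirals or below it in both. A departing strand is above the rows until its
  end, where it is to the right of them.
\<close>
lemma unwind_strands:
  "isotopic_links (closed_curves strands (\<lambda>i t. (x_in i t, climb i t)))
    (closed_curves strands (\<lambda>i t. (x_out i t, climb i t)))"
proof (rule isotopic_segments)
  fix i j :: strand and t :: real
  assume ij: "i \<in> strands" "j \<in> strands" "i \<noteq> j" and t: "t \<in> {0..1}"
  show "same_side (x_in i t, climb i t) (x_in j t, climb j t) (x_out i t, climb i t) (x_out j t, climb j t)"
    using ij
  proof (rule strand_pairs)
    fix a q a' q' assume rows: "Row a q \<in> strands" "Row a' q' \<in> strands" "q < q' \<or> q = q' \<and> a < a'"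
    show "same_side (x_in (Row a q) t, climb (Row a q) t) (x_in (Row a' q') t, climb (Row a' q') t)
        (x_out (Row a q) t, climb (Row a q) t) (x_out (Row a' q') t, climb (Row a' q') t)"
    proof (cases "q < q'")
      case True
      then show ?thesis by (intro same_side_z) auto
    next
      case False
      then have "q = q'" "a < a'" using rows by auto
      then show ?thesis
        using rows t entry_mono[of a a'] by (intro same_side_x rows_in_less rows_out_less) auto
    qed
  next
    fix a q b assume ab: "Row a q \<in> strands" "Out b \<in> strands"
    show "same_side (x_in (Row a q) t, climb (Row a q) t) (x_in (Out b) t, climb (Out b) t)
        (x_out (Row a q) t, climb (Row a q) t) (x_out (Out b) t, climb (Out b) t)"
    proof (cases "t = 1")
      case True
      then show ?thesis
        using row_out_in[OF ab] row_out_out[OF ab]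
        by (auto intro!: same_side_x simp del: end_in.simps end_out.simps)
    next
      case False
      then show ?thesis
        using ab t by (intro same_side_z) (auto intro: less_le_trans[of _ 0])
    qed
  next
    fix a q c assume ac: "Row a q \<in> strands" "In c \<in> strands"
    show "same_side (x_in (Row a q) t, climb (Row a q) t) (x_in (In c) t, climb (In c) t)
        (x_out (Row a q) t, climb (Row a q) t) (x_out (In c) t, climb (In c) t)"
    proof (cases "q < entry c \<or> M * t < 1")
      case True
      then show ?thesis using row_in_in[OF ac t] row_in_out[OF ac t] by (intro same_side_x) auto
    next
      case False
      then show ?thesis using row_climbs_above_in[OF ac(1) t] by (intro same_side_z') auto
    qed
  next
    fix a b assume "Out a \<in> strands" "Out b \<in> strands" "a < b"
    then show "same_side (x_in (Out a) t, climb (Out a) t) (x_in (Out b) t, climb (Out b) t)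
        (x_out (Out a) t, climb (Out a) t) (x_out (Out b) t, climb (Out b) t)"
      using outs_less[of a b t] t by (intro same_side_x) auto
  next
    fix a c assume "Out a \<in> strands" "In c \<in> strands"
    note facts = this
    show "same_side (x_in (Out a) t, climb (Out a) t) (x_in (In c) t, climb (In c) t)
        (x_out (Out a) t, climb (Out a) t) (x_out (In c) t, climb (In c) t)"
    proof (cases "t = 0 \<or> t = 1")
      \<comment> \<open>At the ends the heights may agree, but the positions differ.\<close>
      case True
      then show ?thesis
        using facts out_in_ends[of a c] climb_signs(2)[of t a] climb_signs(3)[of t c]
        by (auto intro: same_side_x same_side_commute[THEN iffD1, OF same_side_x]
            simp del: start_in.simps end_in.simps start_out.simps end_out.simps)
    next
      case False
      then have "0 < t" "t < 1" using t by auto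
      then show ?thesis
        using facts out_in_ends[of a c] climb_signs(2)[of t a] climb_signs(3)[of t c]
        by (intro same_side_z') (auto simp del: climb.simps)
    qed
  next
    fix a b assume "In a \<in> strands" "In b \<in> strands" "a < b"
    then show "same_side (x_in (In a) t, climb (In a) t) (x_in (In b) t, climb (In b) t)
        (x_out (In a) t, climb (In a) t) (x_out (In b) t, climb (In b) t)"
      using ins_less[of a b t] t by (intro same_side_x) auto
  qed (use same_side_commute in blast)
qed (use continuous_heights in auto)

text \<open>
  In the outward spiral, rows and departing strands run in parallel and cross only the arriving
  strands, which are below them for both choices of heights.
\<close>
lemma flatten_outward_strands:
  "isotopic_links (closed_curves strands (\<lambda>i t. (x_out i t, climb i t)))
    (closed_curves strands (\<lambda>i t. (x_out i t, over i t)))"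
proof (rule isotopic_segments)
  fix i j :: strand and t :: real
  assume ij: "i \<in> strands" "j \<in> strands" "i \<noteq> j" and t: "t \<in> {0..1}"
  show "same_side (x_out i t, climb i t) (x_out j t, climb j t) (x_out i t, over i t) (x_out j t, over j t)"
    using ij
  proof (rule strand_pairs)
    fix a q a' q' assume "Row a q \<in> strands" "Row a' q' \<in> strands" "q < q' \<or> q = q' \<and> a < a'"
    then show "same_side (x_out (Row a q) t, climb (Row a q) t) (x_out (Row a' q') t, climb (Row a' q') t)
        (x_out (Row a q) t, over (Row a q) t) (x_out (Row a' q') t, over (Row a' q') t)"
      using rows_out_less[of a q a' q' t] t by (intro same_side_x) auto
  next
    fix a q b assume ab: "Row a q \<in> strands" "Out b \<in> strands"
    show "same_side (x_out (Row a q) t, climb (Row a q) t) (x_out (Out b) t, climb (Out b) t)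
        (x_out (Row a q) t, over (Row a q) t) (x_out (Out b) t, over (Out b) t)"
      using row_out_out[OF ab] t by (intro same_side_x seg_less) auto
  next
    fix a q c assume ac: "Row a q \<in> strands" "In c \<in> strands"
    show "same_side (x_out (Row a q) t, climb (Row a q) t) (x_out (In c) t, climb (In c) t)
        (x_out (Row a q) t, over (Row a q) t) (x_out (In c) t, over (In c) t)"
    proof (cases "q < entry c \<or> M * t < 1")
      case True
      then show ?thesis using row_in_out[OF ac t] by (intro same_side_x) auto
    next
      case False
      then have "t \<noteq> 0" by auto
      show ?thesis
      proof (cases "t = 1")
        case True
        have "end_out (Row a q) \<noteq> end_out (In c)"
        proof
          assume "end_out (Row a q) = end_out (In c)"
          then have "Suc q = entry c \<and> a = c"
            using ac entry_le[of c] by (intro position_inj) auto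
          then show False using False by auto
        qed
        then show ?thesis using True by (intro same_side_x') simp
      next
        case t1: False
        then show ?thesis
          using row_climbs_above_in[OF ac(1) t, of c] False \<open>t \<noteq> 0\<close> t by (intro same_side_z') auto
      qed
    qed
  next
    fix a b assume "Out a \<in> strands" "Out b \<in> strands" "a < b"
    then show "same_side (x_out (Out a) t, climb (Out a) t) (x_out (Out b) t, climb (Out b) t)
        (x_out (Out a) t, over (Out a) t) (x_out (Out b) t, over (Out b) t)"
      using outs_less[of a b t] t by (intro same_side_x) auto
  next
    fix a c assume "Out a \<in> strands" "In c \<in> strands"
    note facts = this
    show "same_side (x_out (Out a) t, climb (Out a) t) (x_out (In c) t, climb (In c) t)
        (x_out (Out a) t, over (Out a) t) (x_out (In c) t, over (In c) t)"
    proof (cases "t = 0 \<or> t = 1")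
      \<comment> \<open>At the ends the heights may agree, but the positions differ.\<close>
      case True
      then show ?thesis
        using facts out_in_ends[of a c] climb_signs(2)[of t a] climb_signs(3)[of t c]
        by (auto intro!: same_side_x' simp del: start_in.simps end_in.simps start_out.simps end_out.simps)
    next
      case False
      then have "0 < t" "t < 1" using t by auto
      then show ?thesis
        using facts out_in_ends[of a c] climb_signs(2)[of t a] climb_signs(3)[of t c]
        by (intro same_side_z') (auto simp del: climb.simps)
    qed
  next
    fix a b assume "In a \<in> strands" "In b \<in> strands" "a < b"
    then show "same_side (x_out (In a) t, climb (In a) t) (x_out (In b) t, climb (In b) t)
        (x_out (In a) t, over (In a) t) (x_out (In b) t, over (In b) t)"
      using ins_less[of a b t] t by (intro same_side_x) auto
  qed (use same_side_commute in blast)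
qed (use continuous_heights in auto)


section \<open>The two Lorenz links\<close>

lemma start_out_image: "start_out ` strands = {1..offset Q + r + s}"
proof (intro equalityI subsetI)
  fix y assume "y \<in> start_out ` strands"
  then obtain i where i: "i \<in> strands" "y = start_out i" by blast
  show "y \<in> {1..offset Q + r + s}"
  proof (cases i)
    case (Row a q)
    then have "start_out i \<le> offset Q"
      using i offset_add_le[of a "q" Q] by auto
    then show ?thesis using i Row by simp
  qed (use i in auto)
next
  fix y assume y: "y \<in> {1..offset Q + r + s}"
  consider "y \<le> offset Q" | "offset Q < y" "y \<le> offset Q + r" | "offset Q + r < y" by linarith
  then show "y \<in> start_out ` strands"
  proof cases
    case 1
    then obtain a q where "y = offset q + a" "1 \<le> a" "entry a \<le> q" "q < Q"
      using y by (rule_tac position_exists[of y Q]) auto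
    then show ?thesis by (intro image_eqI[of _ _ "Row a q"]) auto
  next
    case 2
    then show ?thesis by (intro image_eqI[of _ _ "Out (y - offset Q)"]) auto
  next
    case 3
    then show ?thesis using y by (intro image_eqI[of _ _ "In (y - offset Q - r)"]) auto
  qed
qed

lemma end_in_image: "end_in ` strands = {1..offset Q + s + r}"
proof (intro equalityI subsetI)
  fix y assume "y \<in> end_in ` strands"
  then obtain i where i: "i \<in> strands" "y = end_in i" by blast
  show "y \<in> {1..offset Q + s + r}"
  proof (cases i)
    case (Row a q)
    then have "end_in i \<le> offset Q"
      using i offset_add_le[of a "Q + entry a - Suc q" Q] by auto
    then show ?thesis using i Row by simp
  qed (use i in auto)
next
  fix y assume y: "y \<in> {1..offset Q + s + r}"
  consider "y \<le> offset Q" | "offset Q < y" "y \<le> offset Q + s" | "offset Q + s < y" by linarith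
  then show "y \<in> end_in ` strands"
  proof cases
    case 1
    then obtain a q where "y = offset q + a" "1 \<le> a" "entry a \<le> q" "q < Q"
      using y by (rule_tac position_exists[of y Q]) auto
    then show ?thesis by (intro image_eqI[of _ _ "Row a (Q + entry a - Suc q)"]) auto
  next
    case 2
    then show ?thesis by (intro image_eqI[of _ _ "In (y - offset Q)"]) auto
  next
    case 3
    then show ?thesis using y by (intro image_eqI[of _ _ "Out (y - offset Q - s)"]) auto
  qed
qed

lemma narrow_r: "w \<in> set ws \<Longrightarrow> w \<le> r" and narrow_s: "w \<in> set ws \<Longrightarrow> w \<le> s"
  using narrow by auto

lemma lorenz_link_outward:
  "lorenz_link (twist_vector @ replicate r s) = closed_curves strands (\<lambda>i t. (x_out i t, over i t))"
proof -
  let ?d = "twist_vector @ replicate r s"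
  have "lorenz_link ?d = closed_curves strands (\<lambda>i. lorenz_braid ?d (start_out i))"
    using start_out_image width_d[OF refl r_pos narrow_s]
    by (simp add: lorenz_link_closed_curves closed_curves_image[symmetric])
  also have "\<dots> = closed_curves strands (\<lambda>i t. (x_out i t, over i t))"
  proof (rule closed_curves_cong)
    fix i t assume i: "i \<in> strands"
    show "lorenz_braid ?d (start_out i) t = (x_out i t, over i t)"
    proof (cases i)
      case (Row a q)
      then show ?thesis
        using i lorenz_end_row[OF refl r_pos narrow_s, of a q] offset_add_le[of a q Q]
        by (simp add: lorenz_braid_def seg_def length_twist_vector)
    next
      case (Out a)
      then show ?thesis
        using i lorenz_end_over[OF refl r_pos narrow_s, of a]
        by (simp add: lorenz_braid_def seg_def length_twist_vector)
    next
      case (In c)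
      then show ?thesis
        using i lorenz_end_under[OF refl r_pos narrow_s, of c]
        by (simp add: lorenz_braid_def seg_def length_twist_vector)
    qed
  qed
  finally show ?thesis .
qed

text \<open>
  The half turn reverses time, so the Lorenz braid is indexed here by the end positions of the
  strands of the inward spiral. Its undercrossing strands become the departing ones, and its
  overcrossing strands become the rows and the arriving ones.
\<close>
lemma lorenz_link_inward:
  "isotopic_links (lorenz_link (twist_vector @ replicate s r))
    (closed_curves strands (\<lambda>i t. (x_in i t, under i t)))"
proof -
  let ?d = "twist_vector @ replicate s r"
  have link: "lorenz_link ?d = closed_curves strands (\<lambda>i. lorenz_braid ?d (end_in i))"
    using end_in_image width_d[OF refl s_pos narrow_r]
    by (simp add: lorenz_link_closed_curves closed_curves_image[symmetric])
  have "(fst (lorenz_braid ?d (end_in i) (1 - t)), - snd (lorenz_braid ?d (end_in i) (1 - t))) =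
      (x_in i t, under i t)" if i: "i \<in> strands" for i t
  proof (cases i)
    case (Row a q)
    then have "1 \<le> a" "entry a \<le> Q + entry a - Suc q" "Q + entry a - Suc q < Q" "q < Q"
      using i by auto
    then show ?thesis
      using Row lorenz_end_row[OF refl s_pos narrow_r, of a "Q + entry a - Suc q"]
        offset_add_le[of a "Q + entry a - Suc q" Q]
      by (simp add: lorenz_braid_def seg_def length_twist_vector Suc_diff_Suc)
  next
    case (Out a)
    then show ?thesis
      using i lorenz_end_under[OF refl s_pos narrow_r, of a]
      by (simp add: lorenz_braid_def seg_def length_twist_vector)
  next
    case (In c)
    then show ?thesis
      using i lorenz_end_over[OF refl s_pos narrow_r, of c]
      by (simp add: lorenz_braid_def seg_def length_twist_vector)
  qed
  then have "closed_curves strands (\<lambda>i t. (fst (lorenz_braid ?d (end_in i) (1 - t)),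
      - snd (lorenz_braid ?d (end_in i) (1 - t)))) = closed_curves strands (\<lambda>i t. (x_in i t, under i t))"
    by (intro closed_curves_cong) auto
  then show ?thesis
    using half_turn_isotopy[of "lorenz_link ?d"] unfolding link half_turn_closed_curves by simp
qed

lemma lorenz_links_isotopic:
  "isotopic_links (lorenz_link (twist_vector @ replicate s r)) (lorenz_link (twist_vector @ replicate r s))"
  unfolding lorenz_link_outward
  by (intro isotopic_links_trans[OF lorenz_link_inward] isotopic_links_trans[OF raise_inward_strands]
      isotopic_links_trans[OF unwind_strands] flatten_outward_strands)

end

lemma concat_replicate_mult: "concat (replicate m (replicate w x)) = replicate (m * w) x"
  by (induction m) (simp_all add: replicate_add)

lemma concat_map_concat: "concat (map f (concat xss)) = concat (map (\<lambda>xs. concat (map f xs)) xss)"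
  by (induction xss) simp_all

lemma sorted_runs:
  assumes "\<And>i j. i \<in> set xs \<Longrightarrow> j \<in> set xs \<Longrightarrow> i \<le> j \<Longrightarrow> f i \<le> f j" "sorted xs"
  shows "sorted (concat (map (\<lambda>i::nat. replicate (n i) (f i :: nat)) xs))"
  using assms by (induction xs) (auto simp: sorted_append)

theorem corollary3:
  fixes k :: nat and r s n :: "nat \<Rightarrow> nat"
  assumes "2 \<le> k"
    and "2 \<le> r 1"
    and "strict_mono_on {1..k} r"
    and "\<forall>i\<in>{1..k}. 1 \<le> s i"
    and "r (k - 1) \<le> s k"
    and "\<forall>i\<in>{1..k - 1}. 1 \<le> n i \<and> s i = n i * r i"
  shows "isotopic_links
           (lorenz_link (power_vector r s k))
           (lorenz_link (power_vector r s (k - 1) @ replicate (r k) (s k)))"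
proof -
  \<comment> \<open>As \<open>s i = n i * r i\<close>, the entries \<open>r i\<close> form \<open>n i\<close> square blocks.\<close>
  define ws where "ws = concat (map (\<lambda>i. replicate (n i) (r i)) [1..<k])"
  have mono: "r i \<le> r j" if "1 \<le> i" "i \<le> j" "j \<le> k" for i j
    using strict_mono_on_leD[OF assms(3)] that by simp
  interpret full_twists ws "r k" "s k"
  proof
    show "sorted ws" unfolding ws_def using mono by (intro sorted_runs) auto
    fix w assume "w \<in> set ws"
    then obtain i where "1 \<le> i" "i < k" "w = r i" by (auto simp: ws_def)
    moreover from this have "i \<le> k - 1" by simp
    ultimately show "w \<le> r k \<and> w \<le> s k"
      using mono[of i k] mono[of i "k - 1"] assms(5) by simp
  next
    show "0 < r k" using mono[of 1 k] assms(1,2) by simp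
    show "0 < s k" using assms(1,4) by (simp add: Suc_le_eq)
  qed
  have "map (\<lambda>i. replicate (s i) (r i)) [1..<k] =
      map (\<lambda>i. concat (map (\<lambda>w. replicate w w) (replicate (n i) (r i)))) [1..<k]"
    using assms(6) by (intro map_cong refl) (auto simp: concat_replicate_mult)
  moreover have "twist_vector =
      concat (map (\<lambda>i. concat (map (\<lambda>w. replicate w w) (replicate (n i) (r i)))) [1..<k])"
    unfolding twist_vector_def unfolding ws_def by (simp add: concat_map_concat comp_def)
  moreover have "power_vector r s (k - 1) = concat (map (\<lambda>i. replicate (s i) (r i)) [1..<k])"
    using assms(1) by (simp add: power_vector_def)
  ultimately have "power_vector r s (k - 1) = twist_vector" by (simp only:)
  moreover have "power_vector r s k = power_vector r s (k - 1) @ replicate (s k) (r k)"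
    using assms(1) by (simp add: power_vector_def)
  ultimately show ?thesis using lorenz_links_isotopic by simp
qed

end
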